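(* Let $x_0\subset\mathbb{C}^{n+1}$ be a quadric in canonical form, $x_z$ a quadric confocal to it, and let three points $x_0^0,x_0^1,x_0^2\in x_0$ be given, with corresponding points $x_z^0,x_z^1,x_z^2\in x_z$ under the Ivory affinity, i.e. $x_z^j=\sqrt{R_z}\,x_0^j+C(z)$. Put $V_j^k:=x_z^k-x_0^j$. Then: (1) $V_1^0,V_2^0$ reflect in $x_z$ at $x_z^0$ if and only if $V_0^1,V_0^2$ reflect in $x_0$ at $x_0^0$. (2) Further, in this case, $V_1^0$ is tangent to $x_0$ at $x_0^1$ if and only if $V_2^0$ is tangent to $x_0$ at $x_0^2$. (3) Further, in this last case (when these tangencies hold), the points $x_z^1,x_0^0,x_z^2$ are collinear. (4) Also, $V_0^1$ and $V_1^0$ are tangent to the same set of quadrics confocal to $x_0$; that is, for every quadric $x_{z'}$ confocal to $x_0$, the line through $x_0^0$ with direction $V_0^1$ is tangent to $x_{z'}$ if and only if the line through $x_0^1$ with direction $V_1^0$ is tangent to $x_{z'}$.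
   Context: On $\mathbb{C}^{n+1}$ use the complex bilinear form $\langle x,y\rangle=x^Ty$ and $|x|^2=x^Tx$, with standard basis $e_1,\dots,e_{n+1}$; vectors whose lengths appear in denominators are assumed non-isotropic ($|v|^2\neq0$), $|v|$ being a square root of $|v|^2$. Symmetric Jordan (SJ) blocks: with $f_j:=\frac{e_{2j-1}+ie_{2j}}{\sqrt2}$, $\bar f_j:=\frac{e_{2j-1}-ie_{2j}}{\sqrt2}$, let $J_1:=0$, and $J_{2k}:=\sum_{j=1}^{k-1}(f_j\bar f_{j+1}^T+\bar f_{j+1}f_j^T)+f_kf_k^T$, $J_{2k+1}:=\sum_{j=1}^{k-1}(f_j\bar f_{j+1}^T+\bar f_{j+1}f_j^T)+f_ke_{2k+1}^T+e_{2k+1}f_k^T$ for $k\ge1$. A symmetric matrix is SJ if it is block diagonal with blocks $a_jI_p+J_p$, $a_j\in\mathbb{C}$. For $a\ne0$, $\sqrt{aI_p+J_p}:=\sqrt a\sum_{j=0}^{p-1}\binom{1/2}{j}a^{-j}J_p^j$ with $\sqrt a=\sqrt r e^{i\theta}$ for $a=re^{2i\theta}$, $r>0$, $-\pi<2\theta\le\pi$; square roots of block-diagonal matrices whose blocks are invertible polynomials in the $J_p$ are defined blockwise in the same manner. A quadric in canonical form is $x_0=\{x: x^T(Ax+2B)+C=0\}$ with $A=A^T$ SJ and one of: (i) $A$ invertible, $B=0$, $C=-1$; (ii) $\ker A=\mathbb{C}e_{n+1}$, $B=-e_{n+1}$, $C=0$; (iii) $\ker A=\mathbb{C}f_1$,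 $B=-\bar f_1$, $C=0$. For $z\in\mathbb{C}$ with $z^{-1}\notin\mathrm{spec}(A)$ put $R_z:=I_{n+1}-zA$; the quadric $x_z$ confocal to $x_0$ is $$Q_z(x):=x^TAR_z^{-1}x+2(R_z^{-1}B)^Tx+C+zB^TR_z^{-1}B=0.$$ The Ivory affinity from $x_0$ to $x_z$ is $x_0\mapsto x_z=\sqrt{R_z}\,x_0+C(z)$, where $C(z):=-\left(\frac12\int_0^z(\sqrt{R_w})^{-1}dw\right)B$. Reflection (in the complex setting refractions are also counted as reflections): vectors $V,W$ reflect in a quadric at its point $x$ if, for some choice of sign, $(dx)^T\left(\frac{V}{|V|}\pm\frac{W}{|W|}\right)=0$ for all $dx$ tangent to the quadric at $x$. In (1) the statement is for the same choice of sign, the square roots being chosen with $|V_0^j|=|V_j^0|$ (which is possible since $|V_0^j|^2=|V_j^0|^2$). A vector $V$ is tangent to $x_0$ at $y\in x_0$ if $V^T(Ay+B)=0$. A line $\{y+tV\}$ is tangent to $x_{z'}$ if the quadratic equation $Q_{z'}(y+tV)=0$ in $t$ has a double root, i.e. its discriminant vanishes.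
   Formalization: Part (3) is stated under the additional assumption that the normal $Ax_0^0+B$ of $x_0$ at $x_0^0$ is non-isotropic; without it the collinearity claim fails in general (e.g. for suitable points in $\mathbb{C}^3$ with isotropic normal at $x_0^0$). *)

theory Defs
  imports
    "HOL-Complex_Analysis.Complex_Analysis"
    "Jordan_Normal_Form.Matrix_Kernel"
    "Jordan_Normal_Form.Spectral_Radius"
    "Jordan_Normal_Form.Gauss_Jordan_Elimination"
begin

unbundle no inner_syntax
unbundle no vec_syntax

text \<open>
  Vectors and matrices are those of the Jordan-normal-form library. Its \<open>\<bullet>\<close> is the
  complex bilinear form \<open>x\<^sup>T y\<close>, without conjugation. Library indices start at 0, so
  \<open>e\<^sub>k\<close> is \<open>unit_vec N (k - 1)\<close>; the index \<open>j\<close> of \<open>f\<^sub>j\<close> is kept 1-based.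
\<close>

definition sj_f :: "nat \<Rightarrow> nat \<Rightarrow> complex vec" where
  "sj_f N j = complex_of_real (1 / sqrt 2) \<cdot>\<^sub>v
     (unit_vec N (2 * j - 2) + \<i> \<cdot>\<^sub>v unit_vec N (2 * j - 1))"

definition sj_fbar :: "nat \<Rightarrow> nat \<Rightarrow> complex vec" where
  "sj_fbar N j = complex_of_real (1 / sqrt 2) \<cdot>\<^sub>v
     (unit_vec N (2 * j - 2) - \<i> \<cdot>\<^sub>v unit_vec N (2 * j - 1))"

text \<open>The entry at \<open>(r, s)\<close> of \<open>u v\<^sup>T + v u\<^sup>T\<close>.\<close>

definition sym_outer :: "complex vec \<Rightarrow> complex vec \<Rightarrow> nat \<Rightarrow> nat \<Rightarrow> complex" where
  "sym_outer u v r s = u $ r * v $ s + v $ r * u $ s"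

definition SJ_J :: "nat \<Rightarrow> complex mat" where
  "SJ_J p = (let k = p div 2 in mat p p (\<lambda>(r, s).
     if p \<le> 1 then 0
     else (\<Sum>j = 1..k - 1. sym_outer (sj_f p j) (sj_fbar p (j + 1)) r s)
       + (if even p then sj_f p k $ r * sj_f p k $ s
          else sym_outer (sj_f p k) (unit_vec p (p - 1)) r s)))"

text \<open>
  A symmetric Jordan matrix is given by the list of its blocks, the pair \<open>(a, p)\<close> standing
  for \<open>a I\<^sub>p + J\<^sub>p\<close>. The matrix determines the list, since every \<open>J\<^sub>p\<close> is indecomposable
  and nilpotent.
\<close>

definition SJ_blocks :: "nat \<Rightarrow> (complex \<times> nat) list \<Rightarrow> bool" where
  "SJ_blocks N bs \<longleftrightarrow> (\<forall>(a, p) \<in> set bs. 1 \<le> p) \<and> sum_list (map snd bs) = N"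

definition SJ_mat :: "(complex \<times> nat) list \<Rightarrow> complex mat" where
  "SJ_mat bs = diag_block_mat (map (\<lambda>(a, p). a \<cdot>\<^sub>m 1\<^sub>m p + SJ_J p) bs)"

text \<open>
  The binomial square root of \<open>b I\<^sub>p + M\<close>, for \<open>M\<close> a nilpotent polynomial in \<open>J\<^sub>p\<close> and
  \<open>b \<noteq> 0\<close>. The function \<open>csqrt\<close> is the branch \<open>\<surd>r e\<^sup>i\<^sup>\<theta>\<close> with \<open>-\<pi> < 2\<theta> \<le> \<pi>\<close>.
\<close>

definition block_sqrt :: "nat \<Rightarrow> complex \<Rightarrow> complex mat \<Rightarrow> complex mat" where
  "block_sqrt p b M = mat p p (\<lambda>(r, s).
     csqrt b * (\<Sum>j<p. ((1/2) gchoose j) * (1 / b) ^ j * (M ^\<^sub>m j) $$ (r, s)))"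

definition inv_mat :: "complex mat \<Rightarrow> complex mat" where
  "inv_mat M = the (mat_inverse M)"

definition R_mat :: "complex mat \<Rightarrow> complex \<Rightarrow> complex mat" where
  "R_mat A z = 1\<^sub>m (dim_row A) - z \<cdot>\<^sub>m A"

text \<open>Blockwise, \<open>I - z (a I + J) = (1 - z a) I + (- z) J\<close>.\<close>

definition sqrt_R :: "(complex \<times> nat) list \<Rightarrow> complex \<Rightarrow> complex mat" where
  "sqrt_R bs z = diag_block_mat (map (\<lambda>(a, p). block_sqrt p (1 - z * a) ((- z) \<cdot>\<^sub>m SJ_J p)) bs)"

text \<open>
  The triple \<open>(M, b, c)\<close>, with \<open>M\<close> symmetric, stands for the quadric
  \<open>x\<^sup>T (M x + 2 b) + c = 0\<close>.
\<close>

type_synonym quadric = "complex mat \<times> complex vec \<times> complex"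

fun quadric_val :: "quadric \<Rightarrow> complex vec \<Rightarrow> complex" where
  "quadric_val (M, b, c) x = x \<bullet> (M *\<^sub>v x + 2 \<cdot>\<^sub>v b) + c"

definition on_quadric :: "nat \<Rightarrow> quadric \<Rightarrow> complex vec \<Rightarrow> bool" where
  "on_quadric N q x \<longleftrightarrow> x \<in> carrier_vec N \<and> quadric_val q x = 0"

definition canonical_quadric :: "nat \<Rightarrow> complex mat \<Rightarrow> complex vec \<Rightarrow> complex \<Rightarrow> bool" where
  "canonical_quadric N A B C \<longleftrightarrow>
     invertible_mat A \<and> B = 0\<^sub>v N \<and> C = -1
   \<or> mat_kernel A = range (\<lambda>c. c \<cdot>\<^sub>v unit_vec N (N - 1)) \<and> B = - unit_vec N (N - 1) \<and> C = 0
   \<or> 2 \<le> N \<and> mat_kernel A = range (\<lambda>c. c \<cdot>\<^sub>v sj_f N 1) \<and> B = - sj_fbar N 1 \<and> C = 0"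

text \<open>
  The value \<open>z = 0\<close> is always admissible, as \<open>0\<^sup>-\<^sup>1\<close> is no complex number; the
  library convention \<open>1 / 0 = 0\<close> would exclude it whenever \<open>A\<close> is singular.
\<close>

definition confocal_param :: "complex mat \<Rightarrow> complex \<Rightarrow> bool" where
  "confocal_param A z \<longleftrightarrow> z = 0 \<or> 1 / z \<notin> spectrum A"

definition confocal :: "complex mat \<Rightarrow> complex vec \<Rightarrow> complex \<Rightarrow> complex \<Rightarrow> quadric" where
  "confocal A B C z = (let Ri = inv_mat (R_mat A z)
     in (A * Ri, Ri *\<^sub>v B, C + z * (B \<bullet> (Ri *\<^sub>v B))))"

text \<open>
  The integral of the matrix is taken entrywise along the segment from 0 to \<open>z\<close>. Only the
  block belonging to the kernel of \<open>A\<close> contributes to the product with \<open>B\<close>; there the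
  integrand is a polynomial in \<open>w\<close>, so the choice of path is immaterial. The segment may pass
  through parameters at which another block of \<open>R\<^sub>w\<close> is singular, but those entries
  are multiplied by 0.
\<close>

definition ivory_shift :: "(complex \<times> nat) list \<Rightarrow> complex vec \<Rightarrow> complex \<Rightarrow> complex vec" where
  "ivory_shift bs B z = - (((1/2) \<cdot>\<^sub>m mat (dim_vec B) (dim_vec B) (\<lambda>(r, s).
     contour_integral (linepath 0 z) (\<lambda>w. inv_mat (sqrt_R bs w) $$ (r, s)))) *\<^sub>v B)"

definition ivory :: "(complex \<times> nat) list \<Rightarrow> complex vec \<Rightarrow> complex \<Rightarrow> complex vec \<Rightarrow> complex vec" where
  "ivory bs B z x = sqrt_R bs z *\<^sub>v x + ivory_shift bs B z"

text \<open>Half the gradient of \<open>quadric_val\<close>, by symmetry of \<open>M\<close>.\<close>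

fun normal_at :: "quadric \<Rightarrow> complex vec \<Rightarrow> complex vec" where
  "normal_at (M, b, c) x = M *\<^sub>v x + b"

definition tangent_at :: "quadric \<Rightarrow> complex vec \<Rightarrow> complex vec \<Rightarrow> bool" where
  "tangent_at q x V \<longleftrightarrow> V \<in> carrier_vec (dim_vec x) \<and> V \<bullet> normal_at q x = 0"

text \<open>
  The condition \<open>(dx)\<^sup>T (V/l + s W/m) = 0\<close>, for given square roots \<open>l\<close> and \<open>m\<close> of
  \<open>|V|\<^sup>2\<close> and \<open>|W|\<^sup>2\<close> and a given sign \<open>s\<close>.
\<close>

definition reflect_signed ::
  "quadric \<Rightarrow> complex vec \<Rightarrow> complex \<Rightarrow> complex \<Rightarrow> complex vec \<Rightarrow> complex \<Rightarrow> complex vec \<Rightarrow> bool" where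
  "reflect_signed q x s l V m W \<longleftrightarrow>
     (\<forall>dx. tangent_at q x dx \<longrightarrow> dx \<bullet> ((1 / l) \<cdot>\<^sub>v V + s \<cdot>\<^sub>v ((1 / m) \<cdot>\<^sub>v W)) = 0)"

definition reflect :: "quadric \<Rightarrow> complex vec \<Rightarrow> complex vec \<Rightarrow> complex vec \<Rightarrow> bool" where
  "reflect q x V W \<longleftrightarrow> (\<exists>l m. l\<^sup>2 = V \<bullet> V \<and> m\<^sup>2 = W \<bullet> W \<and>
     (\<exists>s \<in> {1, -1}. reflect_signed q x s l V m W))"

text \<open>The discriminant of \<open>Q(y + t V)\<close> as a polynomial of formal degree 2 in \<open>t\<close> vanishes.\<close>

definition line_tangent :: "quadric \<Rightarrow> complex vec \<Rightarrow> complex vec \<Rightarrow> bool" where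
  "line_tangent q y V \<longleftrightarrow> (\<exists>\<alpha> \<beta> \<gamma>.
     (\<forall>t. quadric_val q (y + t \<cdot>\<^sub>v V) = \<alpha> * t\<^sup>2 + \<beta> * t + \<gamma>) \<and> \<beta>\<^sup>2 - 4 * \<alpha> * \<gamma> = 0)"

text \<open>Collinearity over the complex numbers, in the form of the library's real \<open>collinear\<close>.\<close>

definition collinear_cvec :: "nat \<Rightarrow> complex vec set \<Rightarrow> bool" where
  "collinear_cvec N S \<longleftrightarrow> S \<subseteq> carrier_vec N \<and>
     (\<exists>u \<in> carrier_vec N. \<forall>x \<in> S. \<forall>y \<in> S. \<exists>c. x - y = c \<cdot>\<^sub>v u)"

end

theory Submission
  imports Defs
begin

text \<open>
  All matrices in the statement are blockwise power series in the nilpotent \<open>J\<^sub>p\<close>, one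
  series for each eigenvalue; hence they are symmetric and commute, and identities between
  them are identities of power series. As \<open>B\<close> is supported in a block with eigenvalue 0,
  \<open>c = C(z)\<close> is such a series applied to \<open>B\<close>, with \<open>(S + I) c = - z B\<close> for
  \<open>S = \<surd>R\<^sub>z\<close>. Writing \<open>\<nu>(x) = A x + B\<close> for the half gradient of \<open>x\<^sub>0\<close> at \<open>x\<close>,
  \<open>U = V\<^sub>0\<^sup>1\<close>, \<open>V = V\<^sub>1\<^sup>0\<close>, this gives \<open>S V + U = - z \<nu>(x\<^sub>0\<^sup>0)\<close>,
  \<open>|U|\<^sup>2 = |V|\<^sup>2\<close> and \<open>U \<bullet> \<nu>(x\<^sub>0\<^sup>0) = V \<bullet> \<nu>(x\<^sub>0\<^sup>1)\<close>. The first relation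
  transports reflections, since \<open>S\<close> maps the tangent space of \<open>x\<^sub>0\<close> onto that of \<open>x\<^sub>z\<close>;
  the others reduce the claims on tangency to linear algebra at \<open>x\<^sub>0\<^sup>0\<close>.
\<close>

section \<open>Nilpotency of the Jordan blocks\<close>

no_notation fps_nth (infixl "$" 75)

text \<open>Formal series in X form an integral domain, whereas \<open>SJ_J\<close> has no inverse.
  This is what makes C(z) tractable: it comes from (sqrt(1 - zX) - 1)/X, and its defining relation
  is found by multiplying by X and cancelling. The only analytic ingredient is one term-by-term
  integral, in columns where the integrand is a polynomial in w off finitely many points. The second
  difficulty is that the form is not definite. A nonzero vector may be isotropic, so directions
  cannot be split off by orthogonal projection; parallelism is read off from annihilators instead.
  For the same reason collinearity asks for a nonisotropic normal N: if V/l + s W/m = k N with V and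
  W orthogonal to N, pairing with N yields only k |N|^2 = 0. For tangent lines, the criteria at the
  two ends become comparable after multiplication by powers of z and z', so z = 0 and z' = 0 stand
  apart; they are settled by reversing a line and by the equality of normal components.\<close>

lemma sj_f_carrier [simp]: "sj_f p j \<in> carrier_vec p"
  and sj_fbar_carrier [simp]: "sj_fbar p j \<in> carrier_vec p"
  by (simp_all add: sj_f_def sj_fbar_def)

lemma sj_f_dim [simp]: "dim_vec (sj_f p j) = p" "dim_vec (sj_fbar p j) = p"
  by (simp_all add: sj_f_def sj_fbar_def)

lemma half_of_real_sqrt2: "complex_of_real (1 / sqrt 2) * complex_of_real (1 / sqrt 2) = 1 / 2"
  by (simp flip: of_real_mult)

lemma sj_f_scalar_prod:
  assumes "v \<in> carrier_vec p" "1 \<le> j" "2 * j \<le> p"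
  shows "sj_f p j \<bullet> v = complex_of_real (1 / sqrt 2) * (v $ (2 * j - 2) + \<i> * v $ (2 * j - 1))"
    and "sj_fbar p j \<bullet> v = complex_of_real (1 / sqrt 2) * (v $ (2 * j - 2) - \<i> * v $ (2 * j - 1))"
proof -
  have "unit_vec p (2 * j - 2) \<bullet> v = v $ (2 * j - 2)" "unit_vec p (2 * j - 1) \<bullet> v = v $ (2 * j - 1)"
    using assms by (auto intro: scalar_prod_left_unit)
  then show "sj_f p j \<bullet> v = complex_of_real (1 / sqrt 2) * (v $ (2 * j - 2) + \<i> * v $ (2 * j - 1))"
    and "sj_fbar p j \<bullet> v = complex_of_real (1 / sqrt 2) * (v $ (2 * j - 2) - \<i> * v $ (2 * j - 1))"
    using assms unfolding sj_f_def sj_fbar_def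
    by (simp_all add: add_scalar_prod_distrib[of _ p] minus_scalar_prod_distrib[of _ p])
qed

lemma sj_f_index:
  assumes "1 \<le> j" "2 * j \<le> p" "1 \<le> l" "2 * l \<le> p"
  shows "sj_f p j $ (2 * l - 2) = (if j = l then complex_of_real (1 / sqrt 2) else 0)"
    and "sj_f p j $ (2 * l - 1) = (if j = l then \<i> * complex_of_real (1 / sqrt 2) else 0)"
    and "sj_fbar p j $ (2 * l - 2) = (if j = l then complex_of_real (1 / sqrt 2) else 0)"
    and "sj_fbar p j $ (2 * l - 1) = (if j = l then - \<i> * complex_of_real (1 / sqrt 2) else 0)"
proof -
  \<comment> \<open>Predecessors remove the truncated subtraction: the positions become 2j' and 2j'
    + 1, and parity keeps the two kinds apart.\<close>
  obtain j' l' where "j = Suc j'" "l = Suc l'"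
    using assms by (metis Suc_le_D One_nat_def)
  moreover have "2 * l' \<noteq> Suc (2 * j')" "Suc (2 * l') \<noteq> 2 * j'"
    by presburger+
  ultimately show
    "sj_f p j $ (2 * l - 2) = (if j = l then complex_of_real (1 / sqrt 2) else 0)"
    "sj_f p j $ (2 * l - 1) = (if j = l then \<i> * complex_of_real (1 / sqrt 2) else 0)"
    "sj_fbar p j $ (2 * l - 2) = (if j = l then complex_of_real (1 / sqrt 2) else 0)"
    "sj_fbar p j $ (2 * l - 1) = (if j = l then - \<i> * complex_of_real (1 / sqrt 2) else 0)"
    using assms by (auto simp: sj_f_def sj_fbar_def unit_vec_def)
qed

text \<open>Without conjugation, each pair \<open>sj_f\<close>, \<open>sj_fbar\<close> spans a
  hyperbolic plane and different planes are orthogonal. All later computations with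
  \<open>SJ_J\<close> use these pairings and never its entries.\<close>

lemma sj_isotropic_basis:
  assumes "1 \<le> j" "2 * j \<le> p" "1 \<le> l" "2 * l \<le> p"
  shows "sj_f p l \<bullet> sj_f p j = 0" "sj_fbar p l \<bullet> sj_fbar p j = 0"
    and "sj_f p l \<bullet> sj_fbar p j = (if j = l then 1 else 0)"
    and "sj_fbar p l \<bullet> sj_f p j = (if j = l then 1 else 0)"
proof -
  define c where "c = complex_of_real (1 / sqrt 2)"
  have "c * (c + \<i> * (\<i> * c)) = 0" "c * (c - \<i> * (- \<i> * c)) = 0"
    "c * (c + \<i> * (- \<i> * c)) = 1" "c * (c - \<i> * (\<i> * c)) = 1"
    using half_of_real_sqrt2[folded c_def] by (simp_all add: algebra_simps)
  then show "sj_f p l \<bullet> sj_f p j = 0" "sj_fbar p l \<bullet> sj_fbar p j = 0"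
    "sj_f p l \<bullet> sj_fbar p j = (if j = l then 1 else 0)"
    "sj_fbar p l \<bullet> sj_f p j = (if j = l then 1 else 0)"
    unfolding sj_f_scalar_prod[OF sj_f_carrier assms(3,4)] sj_f_scalar_prod[OF sj_fbar_carrier assms(3,4)]
      sj_f_index[OF assms] c_def[symmetric]
    by simp_all
qed

lemma sj_f_unit_last:
  assumes "odd p" "1 \<le> l" "2 * l \<le> p"
  shows "sj_f p l \<bullet> unit_vec p (p - 1) = 0" "sj_fbar p l \<bullet> unit_vec p (p - 1) = 0"
    "unit_vec p (p - 1) \<bullet> sj_f p l = 0" "unit_vec p (p - 1) \<bullet> sj_fbar p l = 0"
proof -
  have ne: "2 * l - 2 \<noteq> p - 1" "2 * l - 1 \<noteq> p - 1" "p - 1 < p" "2 * l - 2 < p" "2 * l - 1 < p" using assms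
    by (auto; presburger)+
  show 1: "sj_f p l \<bullet> unit_vec p (p - 1) = 0" "sj_fbar p l \<bullet> unit_vec p (p - 1) = 0"
    unfolding sj_f_scalar_prod[OF unit_vec_carrier assms(2,3)] using ne by simp_all
  show "unit_vec p (p - 1) \<bullet> sj_f p l = 0" "unit_vec p (p - 1) \<bullet> sj_fbar p l = 0"
    using 1 by (metis comm_scalar_prod sj_f_carrier sj_fbar_carrier unit_vec_carrier)+
qed

lemma SJ_J_carrier [simp]: "SJ_J p \<in> carrier_mat p p"
  by (simp add: SJ_J_def Let_def)

lemma SJ_J_dim [simp]: "dim_row (SJ_J p) = p" "dim_col (SJ_J p) = p"
  unfolding SJ_J_def Let_def by simp_all

lemma SJ_J_transpose: "transpose_mat (SJ_J p) = SJ_J p"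
  by (rule eq_matI) (auto simp: SJ_J_def Let_def sym_outer_def algebra_simps)

text \<open>\<open>SJ_J\<close> is a sum of rank-one matrices, so its bilinear form is a sum of
  products of pairings. The sum over j sits inside each entry and has to be moved outermost.\<close>

lemma SJ_J_scalar_prod:
  fixes p :: nat
  defines "k \<equiv> p div 2"
  assumes u: "u \<in> carrier_vec p" and v: "v \<in> carrier_vec p" and p: "2 \<le> p"
  shows "u \<bullet> (SJ_J p *\<^sub>v v) =
      (\<Sum>j = 1..k - 1. (u \<bullet> sj_f p j) * (sj_fbar p (j + 1) \<bullet> v) + (u \<bullet> sj_fbar p (j + 1)) * (sj_f p j \<bullet> v))
    + (if even p then (u \<bullet> sj_f p k) * (sj_f p k \<bullet> v)
       else (u \<bullet> sj_f p k) * (unit_vec p (p - 1) \<bullet> v) + (u \<bullet> unit_vec p (p - 1)) * (sj_f p k \<bullet> v))"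
proof -
  have outer: "(\<Sum>r<p. \<Sum>s<p. u $ r * (a $ r * b $ s) * v $ s) = (u \<bullet> a) * (b \<bullet> v)"
    if "a \<in> carrier_vec p" "b \<in> carrier_vec p" for a b
    using that u v by (auto simp: scalar_prod_def atLeast0LessThan sum_product algebra_simps
      intro!: sum.cong)
  have sym: "(\<Sum>r<p. \<Sum>s<p. u $ r * sym_outer a b r s * v $ s) = (u \<bullet> a) * (b \<bullet> v) + (u \<bullet> b) * (a \<bullet> v)"
    if "a \<in> carrier_vec p" "b \<in> carrier_vec p" for a b
    unfolding outer[OF that, symmetric] outer[OF that(2,1), symmetric]
    by (simp add: sym_outer_def ring_distribs sum.distrib)
  have "u \<bullet> (SJ_J p *\<^sub>v v) = (\<Sum>r<p. \<Sum>s<p. u $ r * SJ_J p $$ (r, s) * v $ s)"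
    using u v by (auto simp: scalar_prod_def atLeast0LessThan sum_distrib_left mult.assoc intro!: sum.cong)
  also have "\<dots> = (\<Sum>r<p. \<Sum>s<p. u $ r *
      ((\<Sum>j = 1..k - 1. sym_outer (sj_f p j) (sj_fbar p (j + 1)) r s)
       + (if even p then sj_f p k $ r * sj_f p k $ s
          else sym_outer (sj_f p k) (unit_vec p (p - 1)) r s)) * v $ s)"
    using p by (intro sum.cong refl) (simp add: SJ_J_def Let_def k_def)
  also have "\<dots> = (\<Sum>r<p. \<Sum>s<p. \<Sum>j = 1..k - 1. u $ r * sym_outer (sj_f p j) (sj_fbar p (j + 1)) r s * v $ s)
     + (if even p then (\<Sum>r<p. \<Sum>s<p. u $ r * (sj_f p k $ r * sj_f p k $ s) * v $ s)
        else (\<Sum>r<p. \<Sum>s<p. u $ r * sym_outer (sj_f p k) (unit_vec p (p - 1)) r s * v $ s))"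
    by (simp only: distrib_left distrib_right sum.distrib sum_distrib_left sum_distrib_right) simp
  also have "(\<Sum>r<p. \<Sum>s<p. \<Sum>j = 1..k - 1. u $ r * sym_outer (sj_f p j) (sj_fbar p (j + 1)) r s * v $ s)
     = (\<Sum>r<p. \<Sum>j = 1..k - 1. \<Sum>s<p. u $ r * sym_outer (sj_f p j) (sj_fbar p (j + 1)) r s * v $ s)"
    by (intro sum.cong refl sum.swap)
  also have "\<dots> = (\<Sum>j = 1..k - 1. \<Sum>r<p. \<Sum>s<p. u $ r * sym_outer (sj_f p j) (sj_fbar p (j + 1)) r s * v $ s)"
    by (rule sum.swap)
  finally show ?thesis
    by (simp add: sym outer)
qed

text \<open>One Jordan chain, counted from 0: fbar_1, ..., fbar_k, then the last unit vector if p is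
  odd, then f_k, ..., f_1, and zero from index p on.\<close>

definition sj_chain :: "nat \<Rightarrow> nat \<Rightarrow> complex vec" where
  "sj_chain p i = (if p \<le> i then 0\<^sub>v p else if i < p div 2 then sj_fbar p (i + 1)
     else if odd p \<and> i = p div 2 then unit_vec p (p - 1) else sj_f p (p - i))"

lemma sj_chain_carrier [simp]: "sj_chain p i \<in> carrier_vec p"
  by (simp add: sj_chain_def)

text \<open>Each nonzero chain vector pairs to 1 with one vector of the dual system and to 0 with
  the others, so it selects at most one rank-one term of \<open>SJ_J\<close>; the other factor of
  that term is the next chain vector.\<close>

lemma SJ_J_chain:
  assumes p: "2 \<le> p" and v: "v \<in> carrier_vec p"
  shows "sj_chain p i \<bullet> (SJ_J p *\<^sub>v v) = sj_chain p (Suc i) \<bullet> v"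
proof -
  define k where "k = p div 2"
  have k: "1 \<le> k" "2 * k \<le> p" "p \<le> 2 * k + 1" using p by (auto simp: k_def)
  have pk: "even p \<Longrightarrow> p = 2 * k" "odd p \<Longrightarrow> p = 2 * k + 1" by (auto simp: k_def)
  note J = SJ_J_scalar_prod[OF sj_chain_carrier v p, of i, folded k_def]
  consider "p \<le> i" | "i < k" | "odd p" "i = k" | "i < p" "k \<le> i" "even p \<or> k < i"
    using k by (cases "p \<le> i"; cases "i < k"; cases "i = k"; cases "odd p"; simp)
  then show ?thesis
  proof cases
    case 1
    then show ?thesis using v by (simp add: sj_chain_def mult_mat_vec_carrier[OF SJ_J_carrier])
  next
    case 2
    then have c: "sj_chain p i = sj_fbar p (i + 1)" using k by (simp add: sj_chain_def k_def[symmetric])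
    have "(\<Sum>j = 1..k - 1. (sj_chain p i \<bullet> sj_f p j) * (sj_fbar p (j + 1) \<bullet> v)
        + (sj_chain p i \<bullet> sj_fbar p (j + 1)) * (sj_f p j \<bullet> v))
      = (\<Sum>j = 1..k - 1. if j = i + 1 then sj_fbar p (j + 1) \<bullet> v else 0)"
    proof (intro sum.cong refl)
      fix j assume "j \<in> {1..k - 1}"
      then have "1 \<le> j" "2 * j \<le> p" "2 * (j + 1) \<le> p" "1 \<le> i + 1" "2 * (i + 1) \<le> p"
        using 2 k by auto
      then show "(sj_chain p i \<bullet> sj_f p j) * (sj_fbar p (j + 1) \<bullet> v)
        + (sj_chain p i \<bullet> sj_fbar p (j + 1)) * (sj_f p j \<bullet> v)
        = (if j = i + 1 then sj_fbar p (j + 1) \<bullet> v else 0)"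
        unfolding c by (simp add: sj_isotropic_basis del: One_nat_def)
    qed
    also have "\<dots> = (if i + 1 < k then sj_fbar p (i + 2) \<bullet> v else 0)"
      by (subst sum.delta) auto
    finally have s: "(\<Sum>j = 1..k - 1. (sj_chain p i \<bullet> sj_f p j) * (sj_fbar p (j + 1) \<bullet> v)
        + (sj_chain p i \<bullet> sj_fbar p (j + 1)) * (sj_f p j \<bullet> v))
       = (if i + 1 < k then sj_fbar p (i + 2) \<bullet> v else 0)" .
    have i: "1 \<le> i + 1" "2 * (i + 1) \<le> p" using 2 k by auto
    \<comment> \<open>At the middle of the chain the sum over j is exhausted, and the
      parity-dependent last term of \<open>SJ_J\<close> continues with f_k or with the unit
      vector.\<close>
    consider "i + 1 < k" | "i + 1 = k" "even p" | "i + 1 = k" "odd p" using 2 by linarith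
    then show ?thesis
    proof cases
      case 1
      then have "sj_chain p (Suc i) = sj_fbar p (i + 2)" using k by (simp add: sj_chain_def k_def[symmetric])
      moreover have "sj_chain p i \<bullet> sj_f p k = 0" using 1 i k by (simp add: c sj_isotropic_basis del: One_nat_def)
      moreover have "odd p \<Longrightarrow> sj_chain p i \<bullet> unit_vec p (p - 1) = 0"
        using i unfolding c by (intro sj_f_unit_last)
      ultimately show ?thesis unfolding J s using 1 by simp
    next
      case 2
      then have "sj_chain p (Suc i) = sj_f p k" using k pk(1) by (simp add: sj_chain_def)
      moreover have "sj_chain p i \<bullet> sj_f p k = 1" using 2 i k by (simp add: c sj_isotropic_basis del: One_nat_def)
      ultimately show ?thesis unfolding J s using 2 by simp
    next
      case 3
      then have "sj_chain p (Suc i) = unit_vec p (p - 1)" using k pk(2) by (simp add: sj_chain_def)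
      moreover have "sj_chain p i \<bullet> sj_f p k = 1" using 3 i k by (simp add: c sj_isotropic_basis del: One_nat_def)
      moreover have "sj_chain p i \<bullet> unit_vec p (p - 1) = 0"
        using 3 i unfolding c by (intro sj_f_unit_last)
      ultimately show ?thesis unfolding J s using 3 by simp
    qed
  next
    case 3
    then have c: "sj_chain p i = unit_vec p (p - 1)" using k pk by (simp add: sj_chain_def k_def[symmetric])
    have s: "(\<Sum>j = 1..k - 1. (sj_chain p i \<bullet> sj_f p j) * (sj_fbar p (j + 1) \<bullet> v)
        + (sj_chain p i \<bullet> sj_fbar p (j + 1)) * (sj_f p j \<bullet> v)) = 0"
    proof (intro sum.neutral ballI)
      fix j assume "j \<in> {1..k - 1}"
      then have "1 \<le> j" "2 * j \<le> p" "1 \<le> j + 1" "2 * (j + 1) \<le> p"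
        using k by auto
      then have "sj_chain p i \<bullet> sj_f p j = 0" "sj_chain p i \<bullet> sj_fbar p (j + 1) = 0"
        using 3 unfolding c by (simp_all add: sj_f_unit_last del: One_nat_def scalar_prod_left_unit)
      then show "(sj_chain p i \<bullet> sj_f p j) * (sj_fbar p (j + 1) \<bullet> v)
        + (sj_chain p i \<bullet> sj_fbar p (j + 1)) * (sj_f p j \<bullet> v) = 0"
        by simp
    qed
    have "sj_chain p (Suc i) = sj_f p k" using 3 k pk(2) by (simp add: sj_chain_def)
    moreover have "sj_chain p i \<bullet> sj_f p k = 0"
      using 3 k unfolding c by (intro sj_f_unit_last)
    moreover have "sj_chain p i \<bullet> unit_vec p (p - 1) = 1" using p by (simp add: c)
    ultimately show ?thesis unfolding J s using 3 by simp
  next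
    case 4
    then have c: "sj_chain p i = sj_f p (p - i)" using k by (auto simp add: sj_chain_def k_def[symmetric])
    have l: "1 \<le> p - i" "p - i \<le> k" "2 * (p - i) \<le> p" using 4 k pk by (cases "even p"; force)+
    have "(\<Sum>j = 1..k - 1. (sj_chain p i \<bullet> sj_f p j) * (sj_fbar p (j + 1) \<bullet> v)
        + (sj_chain p i \<bullet> sj_fbar p (j + 1)) * (sj_f p j \<bullet> v))
      = (\<Sum>j = 1..k - 1. if j = p - i - 1 then sj_f p j \<bullet> v else 0)"
    proof (intro sum.cong refl)
      fix j assume "j \<in> {1..k - 1}"
      then have "1 \<le> j" "2 * j \<le> p" "1 \<le> j + 1" "2 * (j + 1) \<le> p" "j + 1 = p - i \<longleftrightarrow> j = p - i - 1"
        using k by auto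
      then show "(sj_chain p i \<bullet> sj_f p j) * (sj_fbar p (j + 1) \<bullet> v)
        + (sj_chain p i \<bullet> sj_fbar p (j + 1)) * (sj_f p j \<bullet> v)
        = (if j = p - i - 1 then sj_f p j \<bullet> v else 0)"
        unfolding c using l by (simp add: sj_isotropic_basis del: One_nat_def)
    qed
    \<comment> \<open>The sum starts at j = 1, so nothing is selected when the current vector is
      f_1: the chain ends there.\<close>
    also have "\<dots> = (if p - i - 1 = 0 then 0 else sj_f p (p - i - 1) \<bullet> v)"
      using l by (subst sum.delta) auto
    finally have s: "(\<Sum>j = 1..k - 1. (sj_chain p i \<bullet> sj_f p j) * (sj_fbar p (j + 1) \<bullet> v)
        + (sj_chain p i \<bullet> sj_fbar p (j + 1)) * (sj_f p j \<bullet> v))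
       = (if p - i - 1 = 0 then 0 else sj_f p (p - i - 1) \<bullet> v)" .
    have "sj_chain p (Suc i) = (if p - i - 1 = 0 then 0\<^sub>v p else sj_f p (p - i - 1))"
      using 4 k by (simp add: sj_chain_def k_def[symmetric])
    then have d: "sj_chain p (Suc i) \<bullet> v = (if p - i - 1 = 0 then 0 else sj_f p (p - i - 1) \<bullet> v)"
      using v by simp
    have "sj_chain p i \<bullet> sj_f p k = 0"
      using l k by (simp add: c sj_isotropic_basis del: One_nat_def)
    moreover have "odd p \<Longrightarrow> sj_chain p i \<bullet> unit_vec p (p - 1) = 0"
      using l unfolding c by (intro sj_f_unit_last)
    ultimately show ?thesis unfolding J s d by simp
  qed
qed

text \<open>The chain is a basis: half sum and half difference of the pairings with f_l and fbar_l
  recover two coordinates up to nonzero factors, and for odd p the unit vector gives the last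
  one.\<close>

lemma sj_chain_separates:
  assumes v: "v \<in> carrier_vec p" and z: "\<And>i. i < p \<Longrightarrow> sj_chain p i \<bullet> v = 0"
  shows "v = 0\<^sub>v p"
proof (rule eq_vecI)
  fix r assume "r < dim_vec (0\<^sub>v p :: complex vec)"
  then have r: "r < p" by simp
  define k where "k = p div 2"
  have pk: "even p \<Longrightarrow> p = 2 * k" "odd p \<Longrightarrow> p = 2 * k + 1" by (auto simp: k_def)
  show "v $ r = 0\<^sub>v p $ r"
  proof (cases "odd p \<and> r = p - 1")
    case True
    then have "k < p" using pk(2) by linarith
    then have "sj_chain p k = unit_vec p (p - 1)" using True by (simp add: sj_chain_def k_def)
    then show ?thesis using z[of k] \<open>k < p\<close> v True r by simp
  next
    case False
    define l where "l = r div 2 + 1"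
    have l: "1 \<le> l" "l \<le> k" "2 * l \<le> p" and rl: "r = 2 * l - 2 \<or> r = 2 * l - 1"
    proof -
      have "r < 2 * k" using False r pk by (cases "even p") auto
      moreover from this have "2 * (r div 2) + 2 \<le> 2 * k" by presburger
      moreover have "r = 2 * (r div 2) \<or> r = 2 * (r div 2) + 1" by presburger
      moreover have "2 * k \<le> p" by (simp add: k_def)
      ultimately show "1 \<le> l" "l \<le> k" "2 * l \<le> p" "r = 2 * l - 2 \<or> r = 2 * l - 1"
        unfolding l_def by auto
    qed
    have "sj_chain p (l - 1) = sj_fbar p l" "l - 1 < p"
      using l r by (auto simp: sj_chain_def k_def[symmetric])
    then have a: "v $ (2 * l - 2) - \<i> * v $ (2 * l - 1) = 0"
      using z[of "l - 1"] sj_f_scalar_prod(2)[OF v l(1,3)] by simp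
    have "2 * k \<le> p" by (simp add: k_def)
    then have "\<not> p - l < k" "odd p \<Longrightarrow> p - l \<noteq> k" "p - l < p" "\<not> p \<le> p - l" "p - (p - l) = l"
      using l pk(2) by linarith+
    then have "sj_chain p (p - l) = sj_f p l" "p - l < p"
      by (auto simp: sj_chain_def k_def[symmetric])
    then have b: "v $ (2 * l - 2) + \<i> * v $ (2 * l - 1) = 0"
      using z[of "p - l"] sj_f_scalar_prod(1)[OF v l(1,3)] by simp
    have "v $ (2 * l - 2) = \<i> * v $ (2 * l - 1)" using a by simp
    then have "v $ (2 * l - 2) = 0" "v $ (2 * l - 1) = 0" using b by simp_all
    then show ?thesis using rl r by auto
  qed
qed (use v in auto)

lemma eq_mat_by_vec:
  fixes M L :: "'a :: semiring_1 mat"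
  assumes M: "M \<in> carrier_mat m k" and L: "L \<in> carrier_mat m k"
    and eq: "\<And>v. v \<in> carrier_vec k \<Longrightarrow> M *\<^sub>v v = L *\<^sub>v v"
  shows "M = L"
proof (rule eq_matI)
  fix r s assume "r < dim_row L" "s < dim_col L"
  then show "M $$ (r, s) = L $$ (r, s)"
    using M L arg_cong[OF eq[of "unit_vec k s"], of "\<lambda>v. v $ r"] by simp
qed (use M L in auto)

text \<open>Applying \<open>SJ_J\<close> m times shifts the chain by m >= p places, into its zero
  tail, and the chain separates vectors. The case p = 1 is the zero matrix and has no chain
  argument.\<close>

lemma SJ_J_nilpotent:
  assumes "1 \<le> p" "p \<le> m" shows "SJ_J p ^\<^sub>m m = 0\<^sub>m p p"
proof (cases "p = 1")
  case True
  have "SJ_J 1 = 0\<^sub>m 1 1" by (rule eq_matI) (auto simp: SJ_J_def Let_def)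
  moreover obtain m' where "m = Suc m'" using assms by (cases m) auto
  ultimately show ?thesis using True
    by (metis SJ_J_carrier pow_carrier_mat pow_mat.simps(2) right_mult_zero_mat)
next
  case False
  then have p: "2 \<le> p" using assms by simp
  have pw: "SJ_J p ^\<^sub>m j \<in> carrier_mat p p" for j by simp
  have chain: "sj_chain p i \<bullet> ((SJ_J p ^\<^sub>m j) *\<^sub>v v) = sj_chain p (i + j) \<bullet> v" if "v \<in> carrier_vec p" for i j v
    using that
  proof (induction j arbitrary: v)
    case (Suc j)
    have "(SJ_J p ^\<^sub>m Suc j) *\<^sub>v v = (SJ_J p ^\<^sub>m j) *\<^sub>v (SJ_J p *\<^sub>v v)"
      using Suc.prems by (simp add: assoc_mult_mat_vec[OF pw SJ_J_carrier])
    then show ?case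
      using Suc.IH[of "SJ_J p *\<^sub>v v"] SJ_J_chain[OF p Suc.prems] Suc.prems
      by (simp add: mult_mat_vec_carrier[OF SJ_J_carrier])
  qed simp
  have "(SJ_J p ^\<^sub>m m) *\<^sub>v v = 0\<^sub>v p" if "v \<in> carrier_vec p" for v
  proof (rule sj_chain_separates)
    show "sj_chain p i \<bullet> ((SJ_J p ^\<^sub>m m) *\<^sub>v v) = 0" for i
      using that assms unfolding chain[OF that] by (simp add: sj_chain_def)
  qed (simp add: mult_mat_vec_carrier[OF pw that])
  then show ?thesis
    by (intro eq_mat_by_vec[OF pw]) auto
qed

section \<open>Power series in a symmetric Jordan matrix\<close>

lemma pow_mat_add:
  assumes "M \<in> carrier_mat n n"
  shows "M ^\<^sub>m (i + j) = M ^\<^sub>m i * M ^\<^sub>m j"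
proof (induction j)
  case (Suc j)
  have "M ^\<^sub>m i * M ^\<^sub>m j * M = M ^\<^sub>m i * (M ^\<^sub>m j * M)"
    using assms by (intro assoc_mult_mat) auto
  with Suc show ?case by simp
qed (use assms in auto)

text \<open>Evaluation of a power series at the nilpotent \<open>SJ_J p\<close>. Cutting off at p
  makes it a finite sum and loses nothing for p >= 1, as higher powers vanish.\<close>

definition J_poly :: "nat \<Rightarrow> complex fps \<Rightarrow> complex mat" where
  "J_poly p F = mat p p (\<lambda>(r, s). \<Sum>j<p. fps_nth F j * (SJ_J p ^\<^sub>m j) $$ (r, s))"

lemma J_poly_carrier [simp]: "J_poly p F \<in> carrier_mat p p"
  by (simp add: J_poly_def)

lemma J_poly_dim [simp]: "dim_row (J_poly p F) = p" "dim_col (J_poly p F) = p"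
  by (simp_all add: J_poly_def)

lemma J_poly_index:
  "r < p \<Longrightarrow> s < p \<Longrightarrow> J_poly p F $$ (r, s) = (\<Sum>j<p. fps_nth F j * (SJ_J p ^\<^sub>m j) $$ (r, s))"
  by (simp add: J_poly_def)

lemma J_poly_add: "J_poly p (F + G) = J_poly p F + J_poly p G"
  by (rule eq_matI) (auto simp: J_poly_index distrib_right sum.distrib)

text \<open>The product of two truncated sums runs over a square, the Cauchy product over a
  triangle. The terms in between carry powers with exponent at least p, which vanish by
  nilpotency.\<close>

lemma J_poly_mult: "J_poly p (F * G) = J_poly p F * J_poly p G"
proof (rule eq_matI)
  fix r s assume "r < dim_row (J_poly p F * J_poly p G)" "s < dim_col (J_poly p F * J_poly p G)"
  then have rs: "r < p" "s < p" by simp_all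
  have J: "(\<Sum>t<p. (SJ_J p ^\<^sub>m i) $$ (r, t) * (SJ_J p ^\<^sub>m j) $$ (t, s)) = (SJ_J p ^\<^sub>m (i + j)) $$ (r, s)" for i j
    using rs by (simp add: pow_mat_add[OF SJ_J_carrier] scalar_prod_def atLeast0LessThan pow_mat_dim)
  have "(J_poly p F * J_poly p G) $$ (r, s)
      = (\<Sum>t<p. (\<Sum>i<p. fps_nth F i * (SJ_J p ^\<^sub>m i) $$ (r, t)) * (\<Sum>j<p. fps_nth G j * (SJ_J p ^\<^sub>m j) $$ (t, s)))"
    using rs by (simp add: scalar_prod_def atLeast0LessThan J_poly_index)
  also have "\<dots> = (\<Sum>t<p. \<Sum>i<p. \<Sum>j<p. fps_nth F i * fps_nth G j *
      ((SJ_J p ^\<^sub>m i) $$ (r, t) * (SJ_J p ^\<^sub>m j) $$ (t, s)))"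
    by (simp add: sum_product mult_ac)
  also have "\<dots> = (\<Sum>i<p. \<Sum>t<p. \<Sum>j<p. fps_nth F i * fps_nth G j *
      ((SJ_J p ^\<^sub>m i) $$ (r, t) * (SJ_J p ^\<^sub>m j) $$ (t, s)))"
    by (rule sum.swap)
  also have "\<dots> = (\<Sum>i<p. \<Sum>j<p. \<Sum>t<p. fps_nth F i * fps_nth G j *
      ((SJ_J p ^\<^sub>m i) $$ (r, t) * (SJ_J p ^\<^sub>m j) $$ (t, s)))"
    by (intro sum.cong refl sum.swap)
  also have "\<dots> = (\<Sum>i<p. \<Sum>j<p. fps_nth F i * fps_nth G j * (SJ_J p ^\<^sub>m (i + j)) $$ (r, s))"
    by (simp add: sum_distrib_left[symmetric] J)
  also have "\<dots> = (\<Sum>(i, j)\<in>{..<p} \<times> {..<p}. fps_nth F i * fps_nth G j * (SJ_J p ^\<^sub>m (i + j)) $$ (r, s))"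
    by (simp add: sum.cartesian_product)
  also have "\<dots> = (\<Sum>(i, j)\<in>{(i, j). i + j < p}. fps_nth F i * fps_nth G j * (SJ_J p ^\<^sub>m (i + j)) $$ (r, s))"
  proof (intro sum.mono_neutral_right ballI)
    fix x assume "x \<in> {..<p} \<times> {..<p} - {(i, j). i + j < p}"
    then have "SJ_J p ^\<^sub>m (fst x + snd x) = 0\<^sub>m p p"
      using rs by (intro SJ_J_nilpotent) auto
    then show "(case x of (i, j) \<Rightarrow> fps_nth F i * fps_nth G j * (SJ_J p ^\<^sub>m (i + j)) $$ (r, s)) = 0"
      using rs by (simp add: case_prod_beta)
  qed auto
  also have "\<dots> = (\<Sum>m<p. \<Sum>i\<le>m. fps_nth F i * fps_nth G (m - i) * (SJ_J p ^\<^sub>m (i + (m - i))) $$ (r, s))"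
    by (rule sum.triangle_reindex)
  also have "\<dots> = (\<Sum>m<p. fps_nth (F * G) m * (SJ_J p ^\<^sub>m m) $$ (r, s))"
    by (simp add: fps_mult_nth sum_distrib_right atLeast0AtMost)
  finally show "J_poly p (F * G) $$ (r, s) = (J_poly p F * J_poly p G) $$ (r, s)"
    using rs by (simp add: J_poly_index)
qed auto

lemma J_poly_const: "J_poly p (fps_const c) = c \<cdot>\<^sub>m 1\<^sub>m p"
proof (rule eq_matI)
  fix r s assume "r < dim_row (c \<cdot>\<^sub>m 1\<^sub>m p)" "s < dim_col (c \<cdot>\<^sub>m 1\<^sub>m p)"
  then have rs: "r < p" "s < p" by simp_all
  have "J_poly p (fps_const c) $$ (r, s) = (\<Sum>j<p. if j = 0 then c * (SJ_J p ^\<^sub>m 0) $$ (r, s) else 0)"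
    using rs unfolding J_poly_index[OF rs] by (intro sum.cong) auto
  then show "J_poly p (fps_const c) $$ (r, s) = (c \<cdot>\<^sub>m 1\<^sub>m p) $$ (r, s)"
    using rs by (simp add: sum.delta)
qed auto

lemma J_poly_X:
  assumes "1 \<le> p" shows "J_poly p fps_X = SJ_J p"
proof (rule eq_matI)
  fix r s assume "r < dim_row (SJ_J p)" "s < dim_col (SJ_J p)"
  then have rs: "r < p" "s < p" by simp_all
  have "J_poly p fps_X $$ (r, s) = (\<Sum>j<p. if j = 1 then (SJ_J p ^\<^sub>m 1) $$ (r, s) else 0)"
    unfolding J_poly_index[OF rs] by (intro sum.cong) auto
  moreover have "SJ_J p ^\<^sub>m 1 = SJ_J p" by simp
  \<comment> \<open>For p = 1 the truncation discards the linear term, in agreement with J_1 =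
    0.\<close>
  moreover have "p = 1 \<Longrightarrow> SJ_J p $$ (r, s) = 0"
    using rs by (auto simp: SJ_J_def Let_def)
  ultimately show "J_poly p fps_X $$ (r, s) = SJ_J p $$ (r, s)"
    using assms by (cases "p = 1") (auto simp: sum.delta)
qed auto

lemma J_poly_linear:
  "1 \<le> p \<Longrightarrow> J_poly p (fps_const a + fps_X) = a \<cdot>\<^sub>m 1\<^sub>m p + SJ_J p"
  by (simp add: J_poly_add J_poly_const J_poly_X)

lemma J_poly_X_power: 
  assumes "p \<le> m" shows "J_poly p (F * fps_X ^ m) = 0\<^sub>m p p"
  using assms by (intro eq_matI) (auto simp: J_poly_index fps_X_power_mult_right_nth)

lemma SJ_J_pow_transpose: "transpose_mat (SJ_J p ^\<^sub>m m) = SJ_J p ^\<^sub>m m"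
proof (induction m)
  case (Suc m)
  have "transpose_mat (SJ_J p ^\<^sub>m m * SJ_J p) = SJ_J p * SJ_J p ^\<^sub>m m"
    using Suc by (simp add: transpose_mult[of _ p p _ p] SJ_J_transpose)
  also have "\<dots> = SJ_J p ^\<^sub>m (1 + m)" by (subst pow_mat_add[OF SJ_J_carrier]) simp
  finally show ?case by simp
qed simp

lemma J_poly_transpose: "transpose_mat (J_poly p F) = J_poly p F"
proof (rule eq_matI)
  fix r s assume "r < dim_row (J_poly p F)" "s < dim_col (J_poly p F)"
  then have rs: "r < p" "s < p" by simp_all
  have "(SJ_J p ^\<^sub>m j) $$ (s, r) = (SJ_J p ^\<^sub>m j) $$ (r, s)" for j
    using arg_cong[OF SJ_J_pow_transpose, of "\<lambda>M. M $$ (r, s)" p j] rs by (simp add: pow_mat_dim)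
  then show "transpose_mat (J_poly p F) $$ (r, s) = J_poly p F $$ (r, s)"
    using rs by (simp add: J_poly_index)
qed auto

section \<open>Functional calculus on block diagonal matrices\<close>

definition SJ_size :: "(complex \<times> nat) list \<Rightarrow> nat" where
  "SJ_size bs = sum_list (map snd bs)"

text \<open>Functional calculus by germs: \<open>F a\<close> is an expansion at the eigenvalue
  \<open>a\<close>, with X standing for A - a I on a block. Indexing by eigenvalue, not by block,
  keeps offsets out of all identities.\<close>

definition SJ_fun :: "(complex \<times> nat) list \<Rightarrow> (complex \<Rightarrow> complex fps) \<Rightarrow> complex mat" where
  "SJ_fun bs F = diag_block_mat (map (\<lambda>(a, p). J_poly p (F a)) bs)"

lemma SJ_fun_dim [simp]: "dim_row (SJ_fun bs F) = SJ_size bs" "dim_col (SJ_fun bs F) = SJ_size bs"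
  by (induction bs) (auto simp: SJ_fun_def SJ_size_def Let_def)

lemma SJ_fun_carrier [simp]: "SJ_fun bs F \<in> carrier_mat (SJ_size bs) (SJ_size bs)"
  by (rule carrier_matI) simp_all

lemma SJ_fun_Nil: "SJ_fun [] F = 0\<^sub>m 0 0"
  by (simp add: SJ_fun_def)

lemma SJ_fun_Cons: "SJ_fun ((a, p) # bs) F =
    four_block_mat (J_poly p (F a)) (0\<^sub>m p (SJ_size bs)) (0\<^sub>m (SJ_size bs) p) (SJ_fun bs F)"
proof -
  have "SJ_fun ((a, p) # bs) F = four_block_mat (J_poly p (F a)) (0\<^sub>m p (dim_col (SJ_fun bs F)))
      (0\<^sub>m (dim_row (SJ_fun bs F)) p) (SJ_fun bs F)"
    by (simp add: SJ_fun_def Let_def del: SJ_fun_dim)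
  then show ?thesis by simp
qed

lemma SJ_size_Cons [simp]: "SJ_size ((a, p) # bs) = p + SJ_size bs" "SJ_size [] = 0"
  by (simp_all add: SJ_size_def)

lemma SJ_fun_cong:
  "(\<And>a p. (a, p) \<in> set bs \<Longrightarrow> F a = G a) \<Longrightarrow> SJ_fun bs F = SJ_fun bs G"
  unfolding SJ_fun_def by (intro arg_cong[of _ _ diag_block_mat] map_cong refl) auto

lemma SJ_fun_mult: "SJ_fun bs (\<lambda>a. F a * G a) = SJ_fun bs F * SJ_fun bs G"
proof (induction bs)
  case (Cons b bs)
  obtain a p where b: "b = (a, p)" by fastforce
  show ?case unfolding b SJ_fun_Cons
    by (subst mult_four_block_mat[of _ p p _ "SJ_size bs" _ "SJ_size bs" _ _ p _ "SJ_size bs"])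
      (simp_all add: Cons.IH J_poly_mult
        right_mult_zero_mat[of _ p p] left_mult_zero_mat[of _ p "SJ_size bs"]
        right_mult_zero_mat[of _ "SJ_size bs" "SJ_size bs"] left_mult_zero_mat[of _ "SJ_size bs" p] 
        mult_carrier_mat[of _ p p] mult_carrier_mat[of _ "SJ_size bs" "SJ_size bs"]
        left_add_zero_mat right_add_zero_mat)
qed (simp add: SJ_fun_Nil)

lemma SJ_fun_commute: "SJ_fun bs F * SJ_fun bs G = SJ_fun bs G * SJ_fun bs F"
  by (simp add: SJ_fun_mult[symmetric] mult.commute)

lemma SJ_fun_add: "SJ_fun bs (\<lambda>a. F a + G a) = SJ_fun bs F + SJ_fun bs G"
proof (induction bs)
  case (Cons b bs)
  obtain a p where b: "b = (a, p)" by fastforce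
  show ?case unfolding b SJ_fun_Cons
    by (subst add_four_block_mat[of _ p p _ "SJ_size bs" _ "SJ_size bs"])
      (simp_all add: Cons.IH J_poly_add)
qed (simp add: SJ_fun_Nil)

lemma SJ_fun_const: "SJ_fun bs (\<lambda>_. fps_const c) = c \<cdot>\<^sub>m 1\<^sub>m (SJ_size bs)"
proof (induction bs)
  case (Cons b bs)
  obtain a p where b: "b = (a, p)" by fastforce
  show ?case unfolding b SJ_fun_Cons
    by (rule eq_matI) (auto simp: Cons.IH J_poly_const)
qed (auto simp: SJ_fun_Nil)

lemma SJ_fun_one: "SJ_fun bs (\<lambda>_. 1) = 1\<^sub>m (SJ_size bs)"
  using SJ_fun_const[of bs 1] by (intro eq_matI) auto

lemma SJ_fun_transpose: "transpose_mat (SJ_fun bs F) = SJ_fun bs F"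
proof (induction bs)
  case (Cons b bs)
  obtain a p where b: "b = (a, p)" by fastforce
  show ?case unfolding b SJ_fun_Cons
    by (subst transpose_four_block_mat[of _ p p _ "SJ_size bs" _ "SJ_size bs"])
      (simp_all add: Cons.IH J_poly_transpose)
qed (auto simp: SJ_fun_Nil)

text \<open>The weights \<open>m k\<close> do not depend on \<open>F\<close>, so an entry can be
  integrated in a parameter of \<open>F\<close> coefficient by coefficient. Entries outside the
  diagonal blocks are the empty sum.\<close>

lemma SJ_fun_entry:
  assumes "r < SJ_size bs" "s < SJ_size bs"
  shows "\<exists>a p m. \<forall>F. SJ_fun bs F $$ (r, s) = (\<Sum>k<(p :: nat). fps_nth (F a) k * m k)"
  using assms
proof (induction bs arbitrary: r s)
  case (Cons b bs)
  obtain a p where b: "b = (a, p)" by fastforce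
  consider "r < p" "s < p" | "r < p" "\<not> s < p" | "\<not> r < p" "s < p" | "\<not> r < p" "\<not> s < p" by blast
  then show ?case
  proof cases
    case 1
    then show ?thesis unfolding b SJ_fun_Cons
      by (intro exI[of _ a] exI[of _ p] exI[of _ "\<lambda>j. (SJ_J p ^\<^sub>m j) $$ (r, s)"]) (simp add: J_poly_index)
  next
    case 4
    then have "r - p < SJ_size bs" "s - p < SJ_size bs" using Cons.prems by (auto simp: b)
    then obtain a' p' m where "\<forall>F. SJ_fun bs F $$ (r - p, s - p) = (\<Sum>k<(p' :: nat). fps_nth (F a') k * m k)"
      using Cons.IH by blast
    then show ?thesis using 4 Cons.prems unfolding b SJ_fun_Cons 
      by (intro exI[of _ a'] exI[of _ p'] exI[of _ m]) (simp add: b)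
  qed (use Cons.prems in \<open>auto intro!: exI[of _ 0] simp: b SJ_fun_Cons\<close>)
qed simp

text \<open>Satisfied if column \<open>s\<close> belongs to a block with eigenvalue \<open>a\<close>; this form
  avoids block offsets.\<close>

definition germ_col :: "(complex \<times> nat) list \<Rightarrow> nat \<Rightarrow> complex \<Rightarrow> bool" where
  "germ_col bs s a \<longleftrightarrow> (\<forall>F G. F a = G a \<longrightarrow> (\<forall>r<SJ_size bs. SJ_fun bs F $$ (r, s) = SJ_fun bs G $$ (r, s)))"

lemma germ_colD:
  "germ_col bs s a \<Longrightarrow> F a = G a \<Longrightarrow> r < SJ_size bs \<Longrightarrow> SJ_fun bs F $$ (r, s) = SJ_fun bs G $$ (r, s)"
  unfolding germ_col_def by blast

lemma germ_col_Cons_first: "s < p \<Longrightarrow> germ_col ((a, p) # bs) s a"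
  unfolding germ_col_def SJ_fun_Cons by simp

lemma germ_col_Cons_later:
  assumes "germ_col bs s b" "s < SJ_size bs" shows "germ_col ((a, p) # bs) (p + s) b"
  unfolding germ_col_def
proof (intro allI impI)
  fix F G :: "complex \<Rightarrow> complex fps" and r
  assume F: "F b = G b" and r: "r < SJ_size ((a, p) # bs)"
  then have "SJ_fun bs F $$ (r - p, s) = SJ_fun bs G $$ (r - p, s)" if "\<not> r < p"
    using that by (intro germ_colD[of bs s b F G, OF assms(1) F]) simp
  then show "SJ_fun ((a, p) # bs) F $$ (r, p + s) = SJ_fun ((a, p) # bs) G $$ (r, p + s)"
    using r assms(2) unfolding SJ_fun_Cons by simp
qed

lemma ex_germ_col:
  assumes "s < SJ_size bs" shows "\<exists>a. germ_col bs s a"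
  using assms
proof (induction bs arbitrary: s)
  case (Cons b bs)
  obtain a p where b: "b = (a, p)" by fastforce
  show ?case
  proof (cases "s < p")
    case False
    then have s: "s - p < SJ_size bs" "p + (s - p) = s" using Cons.prems by (auto simp: b)
    then obtain c where "germ_col bs (s - p) c" using Cons.IH by blast
    from germ_col_Cons_later[OF this s(1), of a p] show ?thesis unfolding b s(2) by blast
  next
    case True
    then show ?thesis unfolding b by (blast intro: germ_col_Cons_first)
  qed
qed simp

lemma block_germ_col:
  assumes "(a, p) \<in> set bs" "1 \<le> p" shows "\<exists>s<SJ_size bs. germ_col bs s a"
  using assms
proof (induction bs)
  case (Cons b bs)
  obtain a' p' where b: "b = (a', p')" by fastforce
  show ?case
  proof (cases "b = (a, p)")
    case True
    then have "germ_col (b # bs) 0 a" using Cons.prems(2) germ_col_Cons_first[of 0 p a bs] by simp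
    moreover have "0 < SJ_size (b # bs)" using True Cons.prems(2) by simp
    ultimately show ?thesis by blast
  next
    case False
    then obtain s where s: "s < SJ_size bs" "germ_col bs s a"
      using Cons.IH[OF _ Cons.prems(2)] Cons.prems(1) by force
    from germ_col_Cons_later[OF s(2,1), of a' p'] s(1) show ?thesis unfolding b
      by (intro exI[of _ "p' + s"]) simp
  qed
qed simp

text \<open>On a vector supported in the columns of one eigenvalue the calculus sees a single
  series. For \<open>B\<close> and eigenvalue 0 this turns identities of vectors into identities at
  \<open>F 0\<close>.\<close>

lemma germ_col_mult_vec:
  assumes "F a = G a" "v \<in> carrier_vec (SJ_size bs)"
    and "\<And>s. s < SJ_size bs \<Longrightarrow> v $ s \<noteq> 0 \<Longrightarrow> germ_col bs s a"
  shows "SJ_fun bs F *\<^sub>v v = SJ_fun bs G *\<^sub>v v"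
proof (rule eq_vecI)
  fix r assume "r < dim_vec (SJ_fun bs G *\<^sub>v v)"
  then have r: "r < SJ_size bs" by simp
  have "SJ_fun bs F $$ (r, s) * v $ s = SJ_fun bs G $$ (r, s) * v $ s" if "s < SJ_size bs" for s
    using germ_colD[of bs s a F G r, OF assms(3)[OF that] assms(1) r] by (cases "v $ s = 0") simp_all
  then show "(SJ_fun bs F *\<^sub>v v) $ r = (SJ_fun bs G *\<^sub>v v) $ r"
    using r assms(2) by (auto simp: scalar_prod_def intro!: sum.cong)
qed simp

section \<open>Inverses within the calculus\<close>

lemma inv_mat_eqI:
  assumes M: "M \<in> carrier_mat n n" and L: "L \<in> carrier_mat n n" and eq: "M * L = 1\<^sub>m n"
  shows "inv_mat M = L"
proof -
  have LM: "L * M = 1\<^sub>m n" by (rule mat_mult_left_right_inverse[OF M L eq])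
  have "M \<in> Units (ring_mat TYPE(complex) n undefined)"
    using M L eq LM by (auto simp: Units_def ring_mat_def)
  then obtain L' where L': "mat_inverse M = Some L'"
    using mat_inverse(1)[OF M, of undefined] by (cases "mat_inverse M") auto
  then have *: "M * L' = 1\<^sub>m n" "L' \<in> carrier_mat n n" using mat_inverse(2)[OF M] by auto
  have "L' = (L * M) * L'" using LM * by simp
  also have "\<dots> = L" using M L * by (simp add: assoc_mult_mat[of _ n n _ n _ n])
  finally show ?thesis by (simp add: inv_mat_def L')
qed

lemma inv_mat_inverse:
  assumes M: "M \<in> carrier_mat n n" and ker: "\<And>v. v \<in> carrier_vec n \<Longrightarrow> M *\<^sub>v v = 0\<^sub>v n \<Longrightarrow> v = 0\<^sub>v n"
  shows "inv_mat M \<in> carrier_mat n n" "M * inv_mat M = 1\<^sub>m n" "inv_mat M * M = 1\<^sub>m n"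
proof -
  have "det M \<noteq> 0" using det_0_iff_vec_prod_zero[OF M] ker by blast
  then have "M \<in> Units (ring_mat TYPE(complex) n undefined)" by (rule det_non_zero_imp_unit[OF M])
  then obtain L where L: "L \<in> carrier_mat n n" "M * L = 1\<^sub>m n" "L * M = 1\<^sub>m n"
    by (auto simp: Units_def ring_mat_def)
  with inv_mat_eqI[OF M L(1,2)]
  show "inv_mat M \<in> carrier_mat n n" "M * inv_mat M = 1\<^sub>m n" "inv_mat M * M = 1\<^sub>m n" by auto
qed

lemma SJ_fun_inverse:
  assumes "\<And>a p. (a, p) \<in> set bs \<Longrightarrow> fps_nth (F a) 0 \<noteq> 0"
  shows "SJ_fun bs F * SJ_fun bs (\<lambda>a. inverse (F a)) = 1\<^sub>m (SJ_size bs)"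
    and "inv_mat (SJ_fun bs F) = SJ_fun bs (\<lambda>a. inverse (F a))"
proof -
  have "SJ_fun bs (\<lambda>a. F a * inverse (F a)) = SJ_fun bs (\<lambda>_. 1)"
  proof (rule SJ_fun_cong)
    show "F a * inverse (F a) = 1" if "(a, p) \<in> set bs" for a p
      using assms[OF that] by (rule inverse_mult_eq_1')
  qed
  then show *: "SJ_fun bs F * SJ_fun bs (\<lambda>a. inverse (F a)) = 1\<^sub>m (SJ_size bs)"
    by (simp add: SJ_fun_mult SJ_fun_one)
  show "inv_mat (SJ_fun bs F) = SJ_fun bs (\<lambda>a. inverse (F a))"
    by (rule inv_mat_eqI[OF _ _ *]) simp_all
qed

section \<open>The matrices of the confocal family as germs\<close>

lemma SJ_mat_eq_SJ_fun:
  assumes "\<And>a p. (a, p) \<in> set bs \<Longrightarrow> 1 \<le> p"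
  shows "SJ_mat bs = SJ_fun bs (\<lambda>a. fps_const a + fps_X)"
  unfolding SJ_mat_def SJ_fun_def using assms
  by (intro arg_cong[of _ _ diag_block_mat] map_cong refl) (auto simp: J_poly_linear)

lemma R_mat_eq_SJ_fun:
  assumes "\<And>a p. (a, p) \<in> set bs \<Longrightarrow> 1 \<le> p"
  shows "R_mat (SJ_mat bs) z = SJ_fun bs (\<lambda>a. 1 - fps_const z * (fps_const a + fps_X))"
proof -
  have A: "SJ_mat bs = SJ_fun bs (\<lambda>a. fps_const a + fps_X)"
    by (rule SJ_mat_eq_SJ_fun) (rule assms)
  have carrier: "SJ_mat bs \<in> carrier_mat (SJ_size bs) (SJ_size bs)" by (simp add: A)
  have "SJ_fun bs (\<lambda>a. 1 - fps_const z * (fps_const a + fps_X))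
     = SJ_fun bs (\<lambda>a. 1 + fps_const (- z) * (fps_const a + fps_X))"
    by (simp add: fps_const_neg[symmetric] del: fps_const_neg)
  also have "\<dots> = 1\<^sub>m (SJ_size bs) + (- z \<cdot>\<^sub>m 1\<^sub>m (SJ_size bs)) * SJ_mat bs"
    by (simp only: SJ_fun_add SJ_fun_one SJ_fun_mult SJ_fun_const A)
  also have "\<dots> = R_mat (SJ_mat bs) z"
    unfolding mult_smult_assoc_mat[OF one_carrier_mat carrier] left_mult_one_mat[OF carrier]
    using carrier unfolding R_mat_def by (intro eq_matI) auto
  finally show ?thesis ..
qed

text \<open>The expansion in X of sqrt(1 - z (a + X)), with the branch fixed by \<open>csqrt\<close>
  at the constant term, which is then factored out.\<close>

definition sqrt_germ :: "complex \<Rightarrow> complex \<Rightarrow> complex fps" where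
  "sqrt_germ z a = fps_const (csqrt (1 - z * a)) *
     (fps_binomial (1/2) oo (fps_const (- z / (1 - z * a)) * fps_X))"

lemma smult_pow_mat:
  fixes M :: "'a :: comm_ring_1 mat"
  assumes "M \<in> carrier_mat n n" shows "(c \<cdot>\<^sub>m M) ^\<^sub>m j = c ^ j \<cdot>\<^sub>m (M ^\<^sub>m j)"
proof (induction j)
  case (Suc j)
  have Mj: "M ^\<^sub>m j \<in> carrier_mat n n" using assms by simp
  have "(c \<cdot>\<^sub>m M) ^\<^sub>m Suc j = (c ^ j \<cdot>\<^sub>m (M ^\<^sub>m j)) * (c \<cdot>\<^sub>m M)" by (simp add: Suc)
  also have "\<dots> = c ^ j \<cdot>\<^sub>m (c \<cdot>\<^sub>m (M ^\<^sub>m j * M))"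
    using assms Mj by (simp only: mult_smult_assoc_mat[OF Mj smult_carrier_mat[OF assms]] mult_smult_distrib[OF Mj assms])
  also have "\<dots> = c ^ Suc j \<cdot>\<^sub>m (M ^\<^sub>m Suc j)" by (intro eq_matI) (simp_all add: mult_ac)
  finally show ?case .
qed (intro eq_matI; use assms in simp)

lemma sqrt_germ_nth:
  "fps_nth (sqrt_germ z a) j = csqrt (1 - z * a) * ((- z / (1 - z * a)) ^ j * ((1 / 2) gchoose j))"
  unfolding sqrt_germ_def by (simp only: fps_mult_left_const_nth fps_nth_compose_linear fps_binomial_nth)

lemma sqrt_R_eq_SJ_fun: "sqrt_R bs z = SJ_fun bs (sqrt_germ z)"
proof -
  have block: "block_sqrt p (1 - z * a) (- z \<cdot>\<^sub>m SJ_J p) = J_poly p (sqrt_germ z a)" for a p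
  proof (rule eq_matI)
    fix r s assume "r < dim_row (J_poly p (sqrt_germ z a))" "s < dim_col (J_poly p (sqrt_germ z a))"
    then have rs: "r < p" "s < p" by simp_all
    have pow: "((- z \<cdot>\<^sub>m SJ_J p) ^\<^sub>m j) $$ (r, s) = (- z) ^ j * (SJ_J p ^\<^sub>m j) $$ (r, s)" for j
      unfolding smult_pow_mat[OF SJ_J_carrier] using rs by simp
    have quot: "(- z / (1 - z * a)) ^ j = (1 / (1 - z * a)) ^ j * (- z) ^ j" for j
      unfolding power_mult_distrib[symmetric] by simp
    show "block_sqrt p (1 - z * a) (- z \<cdot>\<^sub>m SJ_J p) $$ (r, s) = J_poly p (sqrt_germ z a) $$ (r, s)"
      using rs unfolding J_poly_index[OF rs] sqrt_germ_nth quot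
      by (simp add: block_sqrt_def pow sum_distrib_left mult_ac)
  qed (auto simp: block_sqrt_def)
  show ?thesis unfolding sqrt_R_def SJ_fun_def block ..
qed

lemma sqrt_germ_nth_0: "fps_nth (sqrt_germ z a) 0 = csqrt (1 - z * a)"
  by (simp add: sqrt_germ_nth)

text \<open>Exponents of binomial series add under multiplication, so exponent 1/2 squares to 1 + X;
  substituting a series without constant term is multiplicative.\<close>

lemma sqrt_germ_square:
  assumes "1 - z * a \<noteq> 0"
  shows "sqrt_germ z a * sqrt_germ z a = 1 - fps_const z * (fps_const a + fps_X)"
proof -
  define d where "d = 1 - z * a"
  define L where "L = fps_const (- z / d) * fps_X"
  define H where "H = fps_binomial (1/2) oo L"
  have L0: "fps_nth L 0 = 0" by (simp add: L_def)
  have "H * H = (fps_binomial (1/2) * fps_binomial (1/2)) oo L"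
    unfolding H_def by (rule fps_compose_mult_distrib[OF L0, symmetric])
  also have "\<dots> = (1 + fps_X) oo L"
    unfolding fps_binomial_add_mult[symmetric] by (simp add: fps_binomial_1)
  also have "\<dots> = 1 + L"
    using L0 by (simp add: fps_compose_add_distrib)
  finally have HH: "H * H = 1 + L" .
  have dd: "fps_const (csqrt d) * fps_const (csqrt d) = fps_const d"
    using power2_csqrt[of d] by (simp add: power2_eq_square)
  have dL: "fps_const d * L = fps_const (- z) * fps_X"
    using assms unfolding L_def mult.assoc[symmetric] fps_const_mult by (simp add: d_def)
  have "sqrt_germ z a * sqrt_germ z a = (fps_const (csqrt d) * fps_const (csqrt d)) * (H * H)"
    unfolding sqrt_germ_def d_def[symmetric] L_def[symmetric] H_def[symmetric] by (simp only: mult_ac)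
  also have "\<dots> = fps_const d + fps_const (- z) * fps_X"
    unfolding dd HH distrib_left dL by simp
  also have "\<dots> = 1 - fps_const z * (fps_const a + fps_X)"
    by (simp add: fps_eq_iff algebra_simps d_def)
  finally show ?thesis .
qed

lemma smult_mat_mult_vec:
  fixes M :: "'a :: comm_ring_1 mat"
  assumes "M \<in> carrier_mat m n" "v \<in> carrier_vec n"
  shows "(c \<cdot>\<^sub>m M) *\<^sub>v v = c \<cdot>\<^sub>v (M *\<^sub>v v)"
  using assms by (intro eq_vecI) auto

text \<open>A nonzero kernel vector of \<open>R_mat A z\<close> is an eigenvector of
  \<open>A\<close> for 1/z if z is nonzero, and cannot exist for z = 0.\<close>

lemma confocal_param_inverse:
  assumes A: "A \<in> carrier_mat n n" and z: "confocal_param A z"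
  shows "inv_mat (R_mat A z) \<in> carrier_mat n n" "R_mat A z * inv_mat (R_mat A z) = 1\<^sub>m n"
    "inv_mat (R_mat A z) * R_mat A z = 1\<^sub>m n"
proof -
  have R: "R_mat A z \<in> carrier_mat n n" using A unfolding R_mat_def by auto
  have ker: "v = 0\<^sub>v n" if v: "v \<in> carrier_vec n" and eq: "R_mat A z *\<^sub>v v = 0\<^sub>v n" for v
  proof -
    have Av: "v $ i = z * (A *\<^sub>v v) $ i" if i: "i < n" for i
    proof -
      have "R_mat A z *\<^sub>v v = v - z \<cdot>\<^sub>v (A *\<^sub>v v)"
        using A v unfolding R_mat_def
        by (simp add: minus_mult_distrib_mat_vec[of _ n n] smult_mat_mult_vec[of _ n n])
      then have "(v - z \<cdot>\<^sub>v (A *\<^sub>v v)) $ i = 0" using eq i by (metis index_zero_vec(1))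
      then show ?thesis using i A v by simp
    qed
    show ?thesis
    proof (cases "z = 0")
      case True
      then show ?thesis using Av v by (intro eq_vecI) auto
    next
      case False
      have "A *\<^sub>v v = (1 / z) \<cdot>\<^sub>v v"
        using A v Av False by (intro eq_vecI) auto
      then have "v \<noteq> 0\<^sub>v n \<Longrightarrow> 1 / z \<in> spectrum A"
        using A v by (auto simp: spectrum_def eigenvalue_def eigenvector_def)
      then show ?thesis using z False by (auto simp: confocal_param_def)
    qed
  qed
  from inv_mat_inverse[OF R ker]
  show "inv_mat (R_mat A z) \<in> carrier_mat n n" "R_mat A z * inv_mat (R_mat A z) = 1\<^sub>m n"
    "inv_mat (R_mat A z) * R_mat A z = 1\<^sub>m n" by auto
qed

lemma J_poly_zero: "J_poly p 0 = 0\<^sub>m p p"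
  by (rule eq_matI) (auto simp: J_poly_index)

lemma SJ_fun_eq_zero:
  assumes "\<And>a p. (a, p) \<in> set bs \<Longrightarrow> J_poly p (F a) = 0\<^sub>m p p"
  shows "SJ_fun bs F = 0\<^sub>m (SJ_size bs) (SJ_size bs)"
  using assms
proof (induction bs)
  case (Cons b bs)
  obtain a p where b: "b = (a, p)" by fastforce
  have "J_poly p (F a) = 0\<^sub>m p p" "SJ_fun bs F = 0\<^sub>m (SJ_size bs) (SJ_size bs)"
    using Cons by (auto simp: b)
  then show ?case unfolding b SJ_fun_Cons by simp
qed (auto simp: SJ_fun_Nil)

lemma block_size_le: "(a, p) \<in> set bs \<Longrightarrow> p \<le> SJ_size bs"
  unfolding SJ_size_def by (rule member_le_sum_list) (auto intro: image_eqI[where x = "(a, p)"])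

text \<open>This links the spectrum with the listed eigenvalues without constructing an eigenvector.
  If 1 - z a = 0, the invertible R_z is nilpotent on the part belonging to \<open>a\<close>; hence
  the projection onto that part is zero, although the block is not empty.\<close>

lemma confocal_param_germ:
  assumes pos: "\<And>a p. (a, p) \<in> set bs \<Longrightarrow> 1 \<le> p"
    and z: "confocal_param (SJ_mat bs) z" and ap: "(a, p) \<in> set bs"
  shows "1 - z * a \<noteq> 0"
proof
  assume za: "1 - z * a = 0"
  define n where "n = SJ_size bs"
  define R where "R = R_mat (SJ_mat bs) z"
  define r where "r = (\<lambda>x. 1 - fps_const z * (fps_const x + fps_X))"
  \<comment> \<open>\<open>T k\<close> is R^k times the spectral projection onto the eigenvalue
    \<open>a\<close>.\<close>
  define T where "T k = SJ_fun bs (\<lambda>x. r x ^ k * (if x = a then 1 else 0))" for k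
  have R: "R = SJ_fun bs r" unfolding R_def r_def by (rule R_mat_eq_SJ_fun) (rule pos)
  have A: "SJ_mat bs \<in> carrier_mat n n"
    unfolding n_def by (subst SJ_mat_eq_SJ_fun) (use pos in auto)
  have T: "T k \<in> carrier_mat n n" for k by (simp add: T_def n_def)
  have step: "T (Suc k) = R * T k" for k
    unfolding T_def R SJ_fun_mult[symmetric] power_Suc by (simp only: mult.assoc)
  have up: "T k = inv_mat R * T (Suc k)" for k
  proof -
    have "inv_mat R * (R * T k) = inv_mat R * R * T k"
      using confocal_param_inverse(1)[OF A z] T[of k]
      by (intro assoc_mult_mat[symmetric, of _ n n _ n _ n]) (simp_all add: R_def[symmetric], simp add: R n_def)
    also have "\<dots> = T k"
      unfolding R_def confocal_param_inverse(3)[OF A z] using T[of k] by simp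
    finally show ?thesis unfolding step ..
  qed
  have down: "T (Suc k) = 0\<^sub>m n n \<Longrightarrow> T k = 0\<^sub>m n n" for k
    unfolding up[of k] R_def by (simp add: right_mult_zero_mat[OF confocal_param_inverse(1)[OF A z]])
  \<comment> \<open>At \<open>a\<close> the germ of R is -z X, and n bounds every block size, so its
    n-th power vanishes on each such block.\<close>
  have "T n = 0\<^sub>m n n"
    unfolding T_def n_def
  proof (rule SJ_fun_eq_zero)
    fix x q assume xq: "(x, q) \<in> set bs"
    show "J_poly q (r x ^ SJ_size bs * (if x = a then 1 else 0)) = 0\<^sub>m q q"
    proof (cases "x = a")
      case True
      have "r a = fps_const (- z) * fps_X"
      proof -
        have "fps_const z * fps_const a = 1" using za by simp
        then have "r a = - (fps_const z * fps_X)" unfolding r_def distrib_left by simp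
        then show ?thesis by simp
      qed
      then have "r a ^ SJ_size bs = fps_const (- z) ^ SJ_size bs * fps_X ^ SJ_size bs"
        by (simp only: power_mult_distrib)
      then show ?thesis using True block_size_le[OF xq] by (simp only: J_poly_X_power simp_thms if_True mult_1_right)
    qed (simp add: J_poly_zero)
  qed
  then have "T (n - k) = 0\<^sub>m n n" for k
  proof (induction k)
    case (Suc k)
    then show ?case using down[of "n - Suc k"] by (cases "k < n") (auto simp: Suc_diff_Suc)
  qed simp
  from this[of n] have T0: "T 0 = 0\<^sub>m n n" by simp
  \<comment> \<open>In a column of the nonempty block for \<open>a\<close> the projection agrees
    with the identity, which has diagonal entry 1.\<close>
  obtain s where s: "s < n" "germ_col bs s a"
    using block_germ_col[OF ap pos[OF ap]] by (auto simp: n_def)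
  have "T 0 $$ (s, s) = SJ_fun bs (\<lambda>_. 1) $$ (s, s)"
    unfolding T_def by (rule germ_colD[OF s(2)]) (use s in \<open>simp_all add: n_def\<close>)
  then show False using s by (simp add: T0 SJ_fun_one n_def)
qed

section \<open>The shift of the Ivory affinity\<close>

text \<open>The expansion of (sqrt(1 - zX) - 1)/X, which is -1/2 times the integral of 1/sqrt(1 -
  wX) over w from 0 to z. The index shift performs the division by X.\<close>

definition shift_germ :: "complex \<Rightarrow> complex fps" where
  "shift_germ z = Abs_fps (\<lambda>k. ((1/2) gchoose Suc k) * (- z) ^ Suc k)"

lemma sqrt_germ_0: "sqrt_germ z 0 = fps_binomial (1/2) oo (fps_const (- z) * fps_X)"
  by (simp add: fps_eq_iff sqrt_germ_nth)

lemma X_times_shift_germ: "fps_X * shift_germ z = sqrt_germ z 0 - 1"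
proof (rule fps_ext)
  fix n show "fps_nth (fps_X * shift_germ z) n = fps_nth (sqrt_germ z 0 - 1) n"
    by (cases n) (simp_all add: shift_germ_def sqrt_germ_nth)
qed

text \<open>With s the root, (s + 1)(s - 1) = s^2 - 1 = -zX; the factor X is cancelled among series,
  where it is not a zero divisor.\<close>

lemma sqrt_germ_shift_germ: "(1 + sqrt_germ z 0) * shift_germ z = fps_const (- z)"
proof -
  have "fps_X * ((1 + sqrt_germ z 0) * shift_germ z) = (1 + sqrt_germ z 0) * (fps_X * shift_germ z)"
    by (simp only: mult_ac)
  also have "\<dots> = sqrt_germ z 0 * sqrt_germ z 0 - 1"
    unfolding X_times_shift_germ by (simp add: algebra_simps)
  also have "\<dots> = fps_X * fps_const (- z)"
    by (subst sqrt_germ_square) (simp_all add: fps_eq_iff algebra_simps)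
  finally show ?thesis by simp
qed

lemma inverse_sqrt_germ_0: "inverse (sqrt_germ z 0) = fps_binomial (- 1 / 2) oo (fps_const (- z) * fps_X)"
proof -
  let ?L = "fps_const (- z) * fps_X"
  have "sqrt_germ z 0 * (fps_binomial (- 1 / 2) oo ?L) = (fps_binomial (1/2) * fps_binomial (- 1 / 2)) oo ?L"
    unfolding sqrt_germ_0 by (rule fps_compose_mult_distrib[symmetric]) simp
  also have "\<dots> = 1" unfolding fps_binomial_add_mult[symmetric] by simp
  finally show ?thesis by (metis fps_inverse_unique)
qed

text \<open>In a column of eigenvalue 0 the integrand is a polynomial in w with an explicit
  primitive, except at the finitely many w where some block of R_w is singular.\<close>

lemma has_contour_integral_inv_sqrt:
  assumes r: "r < SJ_size bs" and s: "s < SJ_size bs" and col: "germ_col bs s 0"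
  shows "((\<lambda>w. inv_mat (sqrt_R bs w) $$ (r, s)) has_contour_integral
    - 2 * SJ_fun bs (\<lambda>_. shift_germ z) $$ (r, s)) (linepath 0 z)"
proof -
  obtain p m where entry: "SJ_fun bs (\<lambda>_. G) $$ (r, s) = (\<Sum>k<(p :: nat). fps_nth G k * m k)" for G
    using SJ_fun_entry[OF r s] by meson
  define P where "P w = (\<Sum>k<p. fps_nth (shift_germ w) k * m k)" for w
  define I where "I w = (\<Sum>k<p. (- 1 / 2 gchoose k) * (- w) ^ k * m k)" for w
  define bad where "bad = {w. \<exists>(a, p) \<in> set bs. 1 - w * a = 0}"
  have "bad \<subseteq> (\<lambda>(a, p). 1 / a) ` set bs"
  proof
    fix w assume "w \<in> bad"
    then obtain a p where ap: "(a, p) \<in> set bs" and w: "1 - w * a = 0" by (auto simp: bad_def)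
    from w have "a \<noteq> 0" by auto
    with w have "w = 1 / a" by (simp add: field_simps)
    with ap show "w \<in> (\<lambda>(a, p). 1 / a) ` set bs" by force
  qed
  then have bad: "finite bad" by (rule finite_subset) simp
  have I: "inv_mat (sqrt_R bs w) $$ (r, s) = I w" if "w \<notin> bad" for w
  proof -
    have "fps_nth (sqrt_germ w a) 0 \<noteq> 0" if "(a, p) \<in> set bs" for a p
      using \<open>w \<notin> bad\<close> that by (auto simp: bad_def sqrt_germ_nth_0)
    then have "inv_mat (sqrt_R bs w) = SJ_fun bs (\<lambda>a. inverse (sqrt_germ w a))"
      unfolding sqrt_R_eq_SJ_fun by (rule SJ_fun_inverse(2))
    then have "inv_mat (sqrt_R bs w) $$ (r, s) = SJ_fun bs (\<lambda>_. inverse (sqrt_germ w 0)) $$ (r, s)"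
      using germ_colD[OF col _ r, of "\<lambda>a. inverse (sqrt_germ w a)" "\<lambda>_. inverse (sqrt_germ w 0)"] by simp
    also have "\<dots> = I w"
      unfolding entry inverse_sqrt_germ_0 I_def fps_nth_compose_linear by (simp add: mult_ac)
    finally show ?thesis .
  qed
  \<comment> \<open>Absorption for binomial coefficients: this is the derivative of the square root
    in terms of coefficients, and the source of the factor 2.\<close>
  have coeff: "of_nat (Suc k) * ((1/2 :: complex) gchoose Suc k) = 1/2 * (- 1 / 2 gchoose k)" for k
    using gbinomial_absorption[of k "1/2 :: complex"] by simp
  have "((\<lambda>w. - 2 * P w) has_field_derivative I w) (at w)" for w
  proof -
    have deriv: "((\<lambda>w. (- w) ^ Suc k) has_field_derivative (of_nat (Suc k) * (- w) ^ k * (- 1))) (at w)" for k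
      by (rule derivative_eq_intros refl | simp)+
    have "((\<lambda>w. - 2 * P w) has_field_derivative
       - 2 * (\<Sum>k<p. ((1/2) gchoose Suc k) * (of_nat (Suc k) * (- w) ^ k * (- 1)) * m k)) (at w)"
      unfolding P_def shift_germ_def fps_nth_Abs_fps
      by (intro DERIV_cmult DERIV_sum DERIV_cmult_right deriv)
    also have "- 2 * (\<Sum>k<p. ((1/2) gchoose Suc k) * (of_nat (Suc k) * (- w) ^ k * (- 1)) * m k) = I w"
      unfolding I_def sum_distrib_left
    proof (rule sum.cong[OF refl])
      fix k
      have "- 2 * (((1/2) gchoose Suc k) * (of_nat (Suc k) * (- w) ^ k * (- 1)) * m k)
         = 2 * (of_nat (Suc k) * ((1/2) gchoose Suc k)) * (- w) ^ k * m k" by (simp only: mult_ac) simp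
      then show "- 2 * (((1/2) gchoose Suc k) * (of_nat (Suc k) * (- w) ^ k * (- 1)) * m k)
         = (- 1 / 2 gchoose k) * (- w) ^ k * m k" unfolding coeff by simp
    qed
    finally show ?thesis .
  qed
  then have "(I has_contour_integral (- 2 * P (pathfinish (linepath 0 z)) - - 2 * P (pathstart (linepath 0 z))))
      (linepath 0 z)"
    by (intro contour_integral_primitive[where S = UNIV] valid_path_linepath subset_UNIV)
  moreover have "P 0 = 0" by (simp add: P_def shift_germ_def)
  ultimately have int: "(I has_contour_integral - 2 * P z) (linepath 0 z)" by simp
  have "((\<lambda>w. inv_mat (sqrt_R bs w) $$ (r, s)) has_contour_integral - 2 * P z) (linepath 0 z)"
  \<comment> \<open>For nonzero z the segment is injective and meets the exceptional set at finitely
    many times, which do not affect the integral. The constant path is treated apart.\<close>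
  proof (cases "z = 0")
    case True
    then show ?thesis using \<open>P 0 = 0\<close> by (simp add: has_contour_integral_trivial)
  next
    case False
    define T where "T = linepath 0 z -` bad"
    have "inj (linepath 0 z)" using False by (auto simp: inj_def linepath_def)
    then have T: "finite T" unfolding T_def by (rule finite_vimageI[OF bad])
    show ?thesis
      using int unfolding has_contour_integral_linepath
      by (rule has_integral_spike_finite[OF T, rotated]) (auto simp: T_def I)
  qed
  then show ?thesis by (simp add: P_def entry)
qed

lemma ivory_shift_eq:
  assumes B: "B \<in> carrier_vec (SJ_size bs)"
    and supp: "\<And>s. s < SJ_size bs \<Longrightarrow> B $ s \<noteq> 0 \<Longrightarrow> germ_col bs s 0"
  shows "ivory_shift bs B z = SJ_fun bs (\<lambda>_. shift_germ z) *\<^sub>v B"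
proof (rule eq_vecI)
  fix r assume "r < dim_vec (SJ_fun bs (\<lambda>_. shift_germ z) *\<^sub>v B)"
  then have r: "r < SJ_size bs" by simp
  define I where "I s = contour_integral (linepath 0 z) (\<lambda>w. inv_mat (sqrt_R bs w) $$ (r, s))" for s
  \<comment> \<open>The factor -1/2 of C(z) cancels the -2 of the integral. Where \<open>B\<close>
    vanishes, the integral may be anything.\<close>
  have "- (1/2 * I s * B $ s) = SJ_fun bs (\<lambda>_. shift_germ z) $$ (r, s) * B $ s" if "s < SJ_size bs" for s
    using contour_integral_unique[OF has_contour_integral_inv_sqrt[OF r that supp[OF that]]]
    by (cases "B $ s = 0") (simp_all add: I_def)
  then have "(\<Sum>s<SJ_size bs. - (1/2 * I s * B $ s))
      = (\<Sum>s<SJ_size bs. SJ_fun bs (\<lambda>_. shift_germ z) $$ (r, s) * B $ s)"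
    by (intro sum.cong) auto
  then show "ivory_shift bs B z $ r = (SJ_fun bs (\<lambda>_. shift_germ z) *\<^sub>v B) $ r"
    using r B by (simp add: ivory_shift_def scalar_prod_def I_def atLeast0LessThan sum_negf)
qed (use B in \<open>simp add: ivory_shift_def\<close>)

text \<open>For nonzero \<open>a\<close> the series a + X is invertible, and applying its inverse to
  A v = 0 would give v = 0.\<close>

lemma kernel_germ_col:
  assumes pos: "\<And>a p. (a, p) \<in> set bs \<Longrightarrow> 1 \<le> p"
    and v: "v \<in> carrier_vec (SJ_size bs)" "v \<noteq> 0\<^sub>v (SJ_size bs)"
    and ker: "SJ_mat bs *\<^sub>v v = 0\<^sub>v (SJ_size bs)"
    and col: "\<And>s. s < SJ_size bs \<Longrightarrow> v $ s \<noteq> 0 \<Longrightarrow> germ_col bs s a"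
  shows "a = 0"
proof (rule ccontr)
  assume a: "a \<noteq> 0"
  let ?A = "\<lambda>x. fps_const x + fps_X :: complex fps" and ?I = "\<lambda>_. inverse (fps_const a + fps_X)"
  have A: "SJ_mat bs = SJ_fun bs ?A" by (rule SJ_mat_eq_SJ_fun) (rule pos)
  have "SJ_fun bs (\<lambda>x. ?I x * ?A x) *\<^sub>v v = SJ_fun bs ?I *\<^sub>v (SJ_mat bs *\<^sub>v v)"
    unfolding A SJ_fun_mult by (rule assoc_mult_mat_vec[OF SJ_fun_carrier SJ_fun_carrier v(1)])
  also have "\<dots> = 0\<^sub>v (SJ_size bs)"
    unfolding ker by (intro eq_vecI) auto
  finally have zero: "SJ_fun bs (\<lambda>x. ?I x * ?A x) *\<^sub>v v = 0\<^sub>v (SJ_size bs)" .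
  have "SJ_fun bs (\<lambda>x. ?I x * ?A x) *\<^sub>v v = SJ_fun bs (\<lambda>_. 1) *\<^sub>v v"
    by (rule germ_col_mult_vec[where a = a]) (use a v col in \<open>auto intro: inverse_mult_eq_1\<close>)
  then show False using zero v by (simp add: SJ_fun_one)
qed

text \<open>\<open>B\<close> is supported where the generator of the kernel is: both are multiples
  of one unit vector, or they are multiples of fbar_1 and f_1, which share the positions 0 and 1. It
  remains to see that these two positions lie in one block.\<close>

lemma canonical_germ_col:
  assumes pos: "\<And>a p. (a, p) \<in> set bs \<Longrightarrow> 1 \<le> p" and n: "SJ_size bs = n" "1 \<le> n"
    and can: "canonical_quadric n (SJ_mat bs) B C" and s: "s < n" "B $ s \<noteq> 0"
  shows "germ_col bs s 0"
proof -
  have A: "SJ_mat bs = SJ_fun bs (\<lambda>a. fps_const a + fps_X)" by (rule SJ_mat_eq_SJ_fun) (rule pos)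
  have in_kernel: "SJ_mat bs *\<^sub>v v = 0\<^sub>v n" if "mat_kernel (SJ_mat bs) = range (\<lambda>c. c \<cdot>\<^sub>v v)" for v
  proof -
    have "v \<in> range (\<lambda>c. c \<cdot>\<^sub>v v)" by (rule image_eqI[of _ _ 1]) auto
    then show ?thesis using n unfolding that[symmetric] by (simp add: mat_kernel_def A)
  qed
  from can consider "B = 0\<^sub>v n"
    | "mat_kernel (SJ_mat bs) = range (\<lambda>c. c \<cdot>\<^sub>v unit_vec n (n - 1))" "B = - unit_vec n (n - 1)"
    | "2 \<le> n" "mat_kernel (SJ_mat bs) = range (\<lambda>c. c \<cdot>\<^sub>v sj_f n 1)" "B = - sj_fbar n 1"
    unfolding canonical_quadric_def by blast
  then show ?thesis
  proof cases
    case 1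
    then show ?thesis using s by simp
  next
    case 2
    have sn: "s = n - 1" using s n unfolding 2(2) by (cases "s = n - 1") auto
    obtain a where a: "germ_col bs (n - 1) a" using ex_germ_col[of "n - 1" bs] n by auto
    have "a = 0"
    proof (rule kernel_germ_col[where v = "unit_vec n (n - 1)" and bs = bs])
      show "germ_col bs t a" if "t < SJ_size bs" "unit_vec n (n - 1) $ t \<noteq> (0 :: complex)" for t
        using that a n by (cases "t = n - 1") auto
    qed (use pos n in_kernel[OF 2(1)] in auto)
    then show ?thesis using a sn by simp
  next
    case 3
    let ?f = "sj_f n 1"
    have f: "?f $ 0 \<noteq> 0" "?f $ 1 \<noteq> 0" "\<And>t. t < n \<Longrightarrow> ?f $ t \<noteq> 0 \<Longrightarrow> t \<in> {0, 1}"
      and "\<And>t. t < n \<Longrightarrow> sj_fbar n 1 $ t \<noteq> 0 \<Longrightarrow> t \<in> {0, 1}"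
      using 3(1) by (auto simp: sj_f_def sj_fbar_def unit_vec_def split: if_splits)
    then have s01: "s \<in> {0, 1}" using s unfolding 3(3) by auto
    have f0: "?f \<noteq> 0\<^sub>v n" using f(1) 3(1) by (metis index_zero_vec(1) less_le_trans pos2)
    note ker = in_kernel[OF 3(2)]
    obtain a p bs' where bs: "bs = (a, p) # bs'"
      using n by (cases bs) auto
    have p: "1 \<le> p" using pos[of a p] by (simp add: bs)
    have "germ_col bs 0 0 \<and> germ_col bs 1 0"
    proof (cases "p = 1")
      case False
      then have col: "germ_col bs 0 a" "germ_col bs 1 a"
        unfolding bs using p by (auto intro: germ_col_Cons_first)
      have "a = 0"
      proof (rule kernel_germ_col[where v = "?f" and bs = bs])
        show "germ_col bs t a" if "t < SJ_size bs" "?f $ t \<noteq> 0" for t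
          using f(3)[of t] that col n by auto
      qed (use pos n ker f0 in auto)
      then show ?thesis using col by simp
    next
      \<comment> \<open>A first block of size 1 would have eigenvalue 0 and put e_1 into the kernel,
        but a multiple of f_1 with nonzero first coordinate has nonzero second coordinate.\<close>
      case True
      have row: "SJ_mat bs $$ (0, t) = (if t = 0 then a else 0)"
        and col: "SJ_mat bs $$ (t, 0) = (if t = 0 then a else 0)" if "t < n" for t
        using that n unfolding A unfolding bs True SJ_fun_Cons by (auto simp: J_poly_index)
      have "(SJ_mat bs *\<^sub>v ?f) $ 0 = (\<Sum>t<n. SJ_mat bs $$ (0, t) * ?f $ t)"
        using n by (simp add: A scalar_prod_def atLeast0LessThan)
      also have "\<dots> = (\<Sum>t<n. if t = 0 then a * ?f $ 0 else 0)"
        by (intro sum.cong) (auto simp: row)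
      also have "\<dots> = a * ?f $ 0" using n by simp
      finally have a: "a = 0" using ker f(1) n by simp
      have "SJ_mat bs *\<^sub>v unit_vec n 0 = 0\<^sub>v n"
      proof (rule eq_vecI)
        fix t assume "t < dim_vec (0\<^sub>v n :: complex vec)"
        then show "(SJ_mat bs *\<^sub>v unit_vec n 0) $ t = 0\<^sub>v n $ t"
          using n col[of t] a by (simp add: A)
      qed (simp add: A n)
      then have "unit_vec n 0 \<in> range (\<lambda>c. c \<cdot>\<^sub>v ?f)"
        unfolding 3(2)[symmetric] by (simp add: mat_kernel_def A n)
      then obtain c where c: "unit_vec n 0 = c \<cdot>\<^sub>v ?f" by auto
      have "(unit_vec n 0 :: complex vec) $ 0 = c * ?f $ 0" "(unit_vec n 0 :: complex vec) $ 1 = c * ?f $ 1"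
        unfolding c using 3(1) by simp_all
      then have False using f(2) 3(1) by simp
      then show ?thesis ..
    qed
    then show ?thesis using s01 by auto
  qed
qed

lemma canonical_carrier: "canonical_quadric n A B C \<Longrightarrow> B \<in> carrier_vec n"
  unfolding canonical_quadric_def by auto

lemma ivory_shift_identities:
  fixes bs z B
  defines "n \<equiv> SJ_size bs" and "c \<equiv> ivory_shift bs B z"
  assumes pos: "\<And>a p. (a, p) \<in> set bs \<Longrightarrow> 1 \<le> p" and B: "B \<in> carrier_vec n"
    and supp: "\<And>s. s < n \<Longrightarrow> B $ s \<noteq> 0 \<Longrightarrow> germ_col bs s 0"
  shows "c \<in> carrier_vec n"
    and "sqrt_R bs z *\<^sub>v c + c = - z \<cdot>\<^sub>v B"
    and "SJ_mat bs *\<^sub>v c = sqrt_R bs z *\<^sub>v B - B"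
proof -
  have c: "c = SJ_fun bs (\<lambda>_. shift_germ z) *\<^sub>v B"
    unfolding c_def by (rule ivory_shift_eq) (use B supp in \<open>simp_all add: n_def\<close>)
  have A: "SJ_mat bs = SJ_fun bs (\<lambda>a. fps_const a + fps_X)" by (rule SJ_mat_eq_SJ_fun) (rule pos)
  have cong: "SJ_fun bs F *\<^sub>v B = SJ_fun bs G *\<^sub>v B" if "F 0 = G 0" for F G
    using that B supp unfolding n_def by (rule germ_col_mult_vec)
  have F: "SJ_fun bs F \<in> carrier_mat n n" for F by (simp add: n_def)
  have mult: "SJ_fun bs F *\<^sub>v (SJ_fun bs G *\<^sub>v B) = SJ_fun bs (\<lambda>a. F a * G a) *\<^sub>v B" for F G
    unfolding SJ_fun_mult using assoc_mult_mat_vec[OF F F B] by simp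
  have add: "SJ_fun bs F *\<^sub>v B + SJ_fun bs G *\<^sub>v B = SJ_fun bs (\<lambda>a. F a + G a) *\<^sub>v B" for F G
    unfolding SJ_fun_add by (rule add_mult_distrib_mat_vec[OF F F B, symmetric])
  have one: "SJ_fun bs (\<lambda>_. 1) *\<^sub>v B = B" using B by (simp add: SJ_fun_one n_def)
  show "c \<in> carrier_vec n" unfolding c using F B by (rule mult_mat_vec_carrier)
  have "sqrt_R bs z *\<^sub>v c + c = SJ_fun bs (\<lambda>a. sqrt_germ z a * shift_germ z + shift_germ z) *\<^sub>v B"
    unfolding c sqrt_R_eq_SJ_fun mult add ..
  also have "\<dots> = SJ_fun bs (\<lambda>_. fps_const (- z)) *\<^sub>v B"
    by (rule cong) (use sqrt_germ_shift_germ[of z] in \<open>simp add: algebra_simps\<close>)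
  also have "\<dots> = - z \<cdot>\<^sub>v B"
    unfolding SJ_fun_const using B by (simp add: smult_mat_mult_vec[of _ n n] n_def)
  finally show "sqrt_R bs z *\<^sub>v c + c = - z \<cdot>\<^sub>v B" .
  have "SJ_mat bs *\<^sub>v c + B = SJ_fun bs (\<lambda>a. (fps_const a + fps_X) * shift_germ z + 1) *\<^sub>v B"
    unfolding c A mult add[symmetric] one ..
  also have "\<dots> = sqrt_R bs z *\<^sub>v B"
    unfolding sqrt_R_eq_SJ_fun by (rule cong) (simp add: X_times_shift_germ)
  finally have "sqrt_R bs z *\<^sub>v B = SJ_mat bs *\<^sub>v c + B" ..
  then show "SJ_mat bs *\<^sub>v c = sqrt_R bs z *\<^sub>v B - B"
    using B unfolding A n_def by (intro eq_vecI) simp_all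
qed

section \<open>Chords between corresponding points\<close>

lemma symmetric_scalar_prod:
  fixes M :: "'a :: comm_ring_1 mat"
  assumes M: "M \<in> carrier_mat n n" "transpose_mat M = M" and uv: "u \<in> carrier_vec n" "v \<in> carrier_vec n"
  shows "(M *\<^sub>v u) \<bullet> v = u \<bullet> (M *\<^sub>v v)"
  using transpose_vec_mult_scalar[OF M(1) uv(2,1)] unfolding M(2) .

text \<open>If v_i is nonzero, the vectors v_i e_j - v_j e_i annihilate v and force u to be
  proportional to v. This works for isotropic v as well.\<close>

lemma mem_span_of_annihilator:
  fixes u v :: "'a :: field vec"
  assumes u: "u \<in> carrier_vec n" and v: "v \<in> carrier_vec n"
    and ann: "\<And>d. d \<in> carrier_vec n \<Longrightarrow> d \<bullet> v = 0 \<Longrightarrow> d \<bullet> u = 0"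
  shows "\<exists>k. u = k \<cdot>\<^sub>v v"
proof (cases "v = 0\<^sub>v n")
  case True
  have "u $ i = 0" if "i < n" for i
    using ann[of "unit_vec n i"] that u True by simp
  then show ?thesis using u True by (intro exI[of _ 0] eq_vecI) auto
next
  case False
  then obtain i where i: "i < n" "v $ i \<noteq> 0" using v eq_vecI[of v "0\<^sub>v n"] by auto
  have "u $ j = u $ i / v $ i * v $ j" if j: "j < n" for j
  proof -
    define d where "d = v $ i \<cdot>\<^sub>v unit_vec n j - v $ j \<cdot>\<^sub>v unit_vec n i"
    have d: "d \<bullet> w = v $ i * w $ j - v $ j * w $ i" if "w \<in> carrier_vec n" for w
      using that i j unfolding d_def by (simp add: minus_scalar_prod_distrib[of _ n])
    have "d \<bullet> u = 0" by (rule ann) (simp_all add: d_def[symmetric] d v, simp add: d_def)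
    then show ?thesis using i by (simp add: d u field_simps)
  qed
  then show ?thesis using u v by (intro exI[of _ "u $ i / v $ i"] eq_vecI) auto
qed

section \<open>Tangent lines through discriminants\<close>

lemma quadric_val_line:
  fixes M :: "complex mat"
  assumes M: "M \<in> carrier_mat n n" "transpose_mat M = M" and b: "b \<in> carrier_vec n"
    and y: "y \<in> carrier_vec n" and V: "V \<in> carrier_vec n"
  shows "quadric_val (M, b, g) (y + t \<cdot>\<^sub>v V)
    = (V \<bullet> (M *\<^sub>v V)) * t\<^sup>2 + 2 * (V \<bullet> (M *\<^sub>v y + b)) * t + quadric_val (M, b, g) y"
proof -
  have c: "M *\<^sub>v y \<in> carrier_vec n" "M *\<^sub>v V \<in> carrier_vec n" "t \<cdot>\<^sub>v V \<in> carrier_vec n" "2 \<cdot>\<^sub>v b \<in> carrier_vec n"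
    using M y V b by auto
  have yV: "y \<bullet> (M *\<^sub>v V) = V \<bullet> (M *\<^sub>v y)"
    using symmetric_scalar_prod[OF M y V] comm_scalar_prod[OF c(1) V] by simp
  have "M *\<^sub>v (y + t \<cdot>\<^sub>v V) = M *\<^sub>v y + t \<cdot>\<^sub>v (M *\<^sub>v V)"
    using M y V by (simp add: mult_add_distrib_mat_vec[of _ n n] mult_mat_vec[of _ n n])
  then show ?thesis using y V b c M
    by (simp add: scalar_prod_add_distrib[of _ n] add_scalar_prod_distrib[of _ n] yV algebra_simps power2_eq_square)
qed

text \<open>The existentially bound coefficients are unique, since the values at t = 0, 1, -1
  determine a quadratic polynomial; this also covers a vanishing leading coefficient.\<close>

lemma line_tangent_iff:
  assumes M: "M \<in> carrier_mat n n" "transpose_mat M = M" and b: "b \<in> carrier_vec n"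
    and y: "y \<in> carrier_vec n" and V: "V \<in> carrier_vec n"
  shows "line_tangent (M, b, g) y V \<longleftrightarrow>
    (V \<bullet> (M *\<^sub>v y + b))\<^sup>2 = (V \<bullet> (M *\<^sub>v V)) * quadric_val (M, b, g) y"
proof -
  define a h q where "a = V \<bullet> (M *\<^sub>v V)" "h = V \<bullet> (M *\<^sub>v y + b)" "q = quadric_val (M, b, g) y"
  have val: "quadric_val (M, b, g) (y + t \<cdot>\<^sub>v V) = a * t\<^sup>2 + 2 * h * t + q" for t
    unfolding a_h_q_def by (rule quadric_val_line[OF assms])
  have unique: "\<alpha> = a \<and> \<beta> = 2 * h \<and> \<gamma> = q" if eq: "\<forall>t. a * t\<^sup>2 + 2 * h * t + q = \<alpha> * t\<^sup>2 + \<beta> * t + \<gamma>" for \<alpha> \<beta> \<gamma>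
  proof -
    have "q = \<gamma>" using eq[rule_format, of 0] by simp
    moreover have "a + 2 * h + q = \<alpha> + \<beta> + \<gamma>" using eq[rule_format, of 1] by simp
    moreover have "a - 2 * h + q = \<alpha> - \<beta> + \<gamma>" using eq[rule_format, of "-1"] by simp
    ultimately have "q = \<gamma>" and plus: "a + 2 * h = \<alpha> + \<beta>" and minus: "a - 2 * h = \<alpha> - \<beta>" by simp_all
    moreover have "2 * a = (a + 2 * h) + (a - 2 * h)" "2 * (2 * h) = (a + 2 * h) - (a - 2 * h)" by simp_all
    then have "2 * a = 2 * \<alpha>" "2 * (2 * h) = 2 * \<beta>" unfolding plus minus by simp_all
    ultimately show ?thesis by simp
  qed
  have "line_tangent (M, b, g) y V \<longleftrightarrow> (2 * h)\<^sup>2 - 4 * a * q = 0"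
  proof
    assume "line_tangent (M, b, g) y V"
    then obtain \<alpha> \<beta> \<gamma> where eq: "\<forall>t. a * t\<^sup>2 + 2 * h * t + q = \<alpha> * t\<^sup>2 + \<beta> * t + \<gamma>"
      and disc: "\<beta>\<^sup>2 - 4 * \<alpha> * \<gamma> = 0"
      unfolding line_tangent_def val by auto
    show "(2 * h)\<^sup>2 - 4 * a * q = 0" using disc unique[OF eq] by simp
  next
    assume "(2 * h)\<^sup>2 - 4 * a * q = 0"
    then show "line_tangent (M, b, g) y V"
      unfolding line_tangent_def val by (intro exI[of _ a] exI[of _ "2 * h"] exI[of _ q]) simp
  qed
  also have "\<dots> \<longleftrightarrow> h\<^sup>2 = a * q" by (simp add: power2_eq_square)
  finally show ?thesis unfolding a_h_q_def .
qed

text \<open>The substitution t -> 1 - t preserves the discriminant.\<close>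

lemma line_tangent_reverse:
  assumes "y \<in> carrier_vec n" "V \<in> carrier_vec n" and tan: "line_tangent q y V"
  shows "line_tangent q (y + V) (- V)"
proof -
  obtain \<alpha> \<beta> \<gamma> where val: "\<And>t. quadric_val q (y + t \<cdot>\<^sub>v V) = \<alpha> * t\<^sup>2 + \<beta> * t + \<gamma>" and disc: "\<beta>\<^sup>2 - 4 * \<alpha> * \<gamma> = 0"
    using tan unfolding line_tangent_def by blast
  have "y + V + t \<cdot>\<^sub>v (- V) = y + (1 - t) \<cdot>\<^sub>v V" for t
    using assms by (intro eq_vecI) (auto simp: algebra_simps)
  then have "quadric_val q (y + V + t \<cdot>\<^sub>v (- V)) = \<alpha> * t\<^sup>2 + (- 2 * \<alpha> - \<beta>) * t + (\<alpha> + \<beta> + \<gamma>)" for t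
    using val[of "1 - t"] by (simp add: power2_eq_square algebra_simps)
  moreover have "(- 2 * \<alpha> - \<beta>)\<^sup>2 - 4 * \<alpha> * (\<alpha> + \<beta> + \<gamma>) = 0"
    using disc by (simp add: power2_eq_square algebra_simps)
  ultimately show ?thesis unfolding line_tangent_def by blast
qed

lemma collinear_cvecI:
  assumes "y \<in> carrier_vec n" "u \<in> carrier_vec n" and S: "\<And>x. x \<in> S \<Longrightarrow> \<exists>\<tau>. x = y + \<tau> \<cdot>\<^sub>v u"
  shows "collinear_cvec n S"
  unfolding collinear_cvec_def
proof (intro conjI bexI[of _ u] ballI subsetI)
  show "x \<in> carrier_vec n" if "x \<in> S" for x using S[OF that] assms(1,2) by auto
  show "\<exists>c. x - x' = c \<cdot>\<^sub>v u" if xs: "x \<in> S" "x' \<in> S" for x x'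
  proof -
    obtain \<tau> \<tau>' where "x = y + \<tau> \<cdot>\<^sub>v u" "x' = y + \<tau>' \<cdot>\<^sub>v u" using S xs by blast
    then have "x - x' = (\<tau> - \<tau>') \<cdot>\<^sub>v u"
      using assms(1,2) by (intro eq_vecI) (auto simp: algebra_simps)
    then show ?thesis ..
  qed
qed fact

text \<open>The geometry of chords depends on these identities alone, whatever the Jordan type.
  \<open>S_zero\<close> fixes the branch at z = 0, where \<open>S_square\<close> would also admit
  -I.\<close>

locale ivory_affinity =
  fixes n :: nat and A S :: "complex mat" and B c :: "complex vec" and z C :: complex
  assumes A [simp]: "A \<in> carrier_mat n n" and S [simp]: "S \<in> carrier_mat n n"
    and B [simp]: "B \<in> carrier_vec n" and c [simp]: "c \<in> carrier_vec n"
    and A_symmetric: "transpose_mat A = A" and S_symmetric: "transpose_mat S = S"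
    and S_commute: "A * S = S * A"
    and S_square: "S * S = R_mat A z"
    and S_zero: "z = 0 \<Longrightarrow> S = 1\<^sub>m n"
    and S_shift: "S *\<^sub>v c + c = - z \<cdot>\<^sub>v B"
    and A_shift: "A *\<^sub>v c = S *\<^sub>v B - B"
begin

section \<open>Lengths and normal components of chords\<close>

definition nrm :: "complex vec \<Rightarrow> complex vec" where "nrm x = A *\<^sub>v x + B"
definition chord :: "complex vec \<Rightarrow> complex vec \<Rightarrow> complex vec" where "chord x y = (S *\<^sub>v y + c) - x"

lemma dims [simp]: "dim_row A = n" "dim_col A = n" "dim_row S = n" "dim_col S = n" "dim_vec B = n" "dim_vec c = n"
  using carrier_matD[OF A] carrier_matD[OF S] carrier_vecD[OF B] carrier_vecD[OF c] by blast+

lemma image_carrier [simp]: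
  assumes [simp]: "x \<in> carrier_vec n"
  shows "A *\<^sub>v x \<in> carrier_vec n" "S *\<^sub>v x \<in> carrier_vec n" "nrm x \<in> carrier_vec n"
  by (simp_all add: nrm_def mult_mat_vec_carrier[OF A] mult_mat_vec_carrier[OF S])

lemma chord_carrier [simp]: "x \<in> carrier_vec n \<Longrightarrow> y \<in> carrier_vec n \<Longrightarrow> chord x y \<in> carrier_vec n"
  by (simp add: chord_def)

lemma S_S: assumes [simp]: "v \<in> carrier_vec n" shows "S *\<^sub>v (S *\<^sub>v v) = v - z \<cdot>\<^sub>v (A *\<^sub>v v)"
proof -
  have "S *\<^sub>v (S *\<^sub>v v) = (S * S) *\<^sub>v v" by (rule assoc_mult_mat_vec[symmetric, OF S S assms])
  also have "\<dots> = 1\<^sub>m n *\<^sub>v v - (z \<cdot>\<^sub>m A) *\<^sub>v v"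
    unfolding S_square R_mat_def by (simp add: minus_mult_distrib_mat_vec[of _ n n])
  finally show ?thesis by (simp add: smult_mat_mult_vec[of _ n n])
qed

lemma A_S: "v \<in> carrier_vec n \<Longrightarrow> A *\<^sub>v (S *\<^sub>v v) = S *\<^sub>v (A *\<^sub>v v)"
  using S_commute assoc_mult_mat_vec[OF A S, of v] assoc_mult_mat_vec[OF S A, of v] by simp

lemma S_c: "S *\<^sub>v c = - z \<cdot>\<^sub>v B - c"
proof (rule eq_vecI)
  fix i assume "i < dim_vec (- z \<cdot>\<^sub>v B - c)"
  then show "(S *\<^sub>v c) $ i = (- z \<cdot>\<^sub>v B - c) $ i"
    using arg_cong[OF S_shift, of "\<lambda>v. v $ i"] by (simp add: eq_diff_eq)
qed simp

lemmas dot_simps = scalar_prod_add_distrib[of _ n] add_scalar_prod_distrib[of _ n]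
  scalar_prod_minus_distrib[of _ n] minus_scalar_prod_distrib[of _ n]

lemmas A_adj = symmetric_scalar_prod[OF A A_symmetric]
lemmas S_adj = symmetric_scalar_prod[OF S S_symmetric]

text \<open>S^2 x contributes -z A x and S c contributes -z B; together they form the half gradient,
  and the rest is the other chord.\<close>

lemma S_chord:
  assumes [simp]: "x \<in> carrier_vec n" "y \<in> carrier_vec n"
  shows "S *\<^sub>v chord y x = - z \<cdot>\<^sub>v nrm x - chord x y"
proof -
  have [simp]: "dim_vec x = n" "dim_vec y = n" using carrier_vecD[OF assms(1)] carrier_vecD[OF assms(2)] by blast+
  have "S *\<^sub>v chord y x = S *\<^sub>v (S *\<^sub>v x) + S *\<^sub>v c - S *\<^sub>v y"
    by (simp add: chord_def mult_minus_distrib_mat_vec[of _ n n] mult_add_distrib_mat_vec[of _ n n])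
  also have "\<dots> = - z \<cdot>\<^sub>v nrm x - chord x y"
    unfolding S_S[OF assms(1)] S_c
    by (rule eq_vecI) (simp_all add: chord_def nrm_def algebra_simps)
  finally show ?thesis .
qed

text \<open>Ivory's theorem on lengths. In the expanded square the terms with factor z add up to z C
  because the mapped point lies on the quadric; what is left is symmetric in the two points.\<close>

lemma chord_norm:
  assumes [simp]: "x \<in> carrier_vec n" "y \<in> carrier_vec n"
    and x: "quadric_val (A, B, C) x = 0" and y: "quadric_val (A, B, C) y = 0"
  shows "chord x y \<bullet> chord x y = chord y x \<bullet> chord y x"
proof -
  have expand: "chord u v \<bullet> chord u v = u \<bullet> u + v \<bullet> v + c \<bullet> c + z * C - 2 * (c \<bullet> u) - 2 * (c \<bullet> v) - 2 * (u \<bullet> (S *\<^sub>v v))"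
    if [simp]: "u \<in> carrier_vec n" "v \<in> carrier_vec n" and v: "quadric_val (A, B, C) v = 0" for u v
  proof -
    have SvSv: "(S *\<^sub>v v) \<bullet> (S *\<^sub>v v) = v \<bullet> v - z * (v \<bullet> (A *\<^sub>v v))"
      by (simp add: S_adj S_S dot_simps)
    have Svc: "(S *\<^sub>v v) \<bullet> c = - z * (v \<bullet> B) - v \<bullet> c"
      by (simp add: S_adj S_c dot_simps)
    have "v \<bullet> (A *\<^sub>v v) + 2 * (v \<bullet> B) + C = 0"
      using v by (simp add: dot_simps)
    then have val: "v \<bullet> (A *\<^sub>v v) = - 2 * (v \<bullet> B) - C" by (simp add: algebra_simps eq_neg_iff_add_eq_0)
    have comm: "u \<bullet> c = c \<bullet> u" "v \<bullet> c = c \<bullet> v" "(S *\<^sub>v v) \<bullet> u = u \<bullet> (S *\<^sub>v v)" "c \<bullet> (S *\<^sub>v v) = (S *\<^sub>v v) \<bullet> c"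
      by (rule comm_scalar_prod[of _ n]; simp)+
    show ?thesis unfolding chord_def
      by (simp add: dot_simps comm(1,3,4) SvSv Svc val comm(2) algebra_simps)
  qed
  have "x \<bullet> (S *\<^sub>v y) = y \<bullet> (S *\<^sub>v x)"
    using S_adj[OF assms(1,2)] comm_scalar_prod[of "S *\<^sub>v x" n y] by simp
  then show ?thesis unfolding expand[OF assms(1,2) y] expand[OF assms(2,1) x] by simp
qed

text \<open>Membership of the base point and A c = S B - B remove every term that distinguishes the
  two points.\<close>

lemma chord_normal:
  assumes [simp]: "x \<in> carrier_vec n" "y \<in> carrier_vec n"
    and x: "quadric_val (A, B, C) x = 0" and y: "quadric_val (A, B, C) y = 0"
  shows "chord x y \<bullet> nrm x = chord y x \<bullet> nrm y"
proof -
  have expand: "chord u v \<bullet> nrm u = u \<bullet> (S *\<^sub>v (A *\<^sub>v v)) + B \<bullet> (S *\<^sub>v u) + B \<bullet> (S *\<^sub>v v) + B \<bullet> c + C"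
    if [simp]: "u \<in> carrier_vec n" "v \<in> carrier_vec n" and u: "quadric_val (A, B, C) u = 0" for u v
  proof -
    have "u \<bullet> (A *\<^sub>v u) + 2 * (u \<bullet> B) + C = 0"
      using u by (simp add: dot_simps)
    then have val: "u \<bullet> (A *\<^sub>v u) = - 2 * (u \<bullet> B) - C" by (simp add: algebra_simps eq_neg_iff_add_eq_0)
    have "(S *\<^sub>v v) \<bullet> (A *\<^sub>v u) = u \<bullet> (S *\<^sub>v (A *\<^sub>v v))"
      using A_adj[of "S *\<^sub>v v" u] by (simp add: A_S comm_scalar_prod[of _ n u])
    moreover have "c \<bullet> (A *\<^sub>v u) = B \<bullet> (S *\<^sub>v u) - u \<bullet> B"
      using A_adj[of c u] by (simp add: A_shift dot_simps S_adj comm_scalar_prod[of B n u])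
    moreover have "(S *\<^sub>v v) \<bullet> B = B \<bullet> (S *\<^sub>v v)" "c \<bullet> B = B \<bullet> c"
      by (rule comm_scalar_prod[of _ n]; simp)+
    ultimately show ?thesis unfolding chord_def nrm_def
      by (simp add: dot_simps val algebra_simps)
  qed
  show ?thesis unfolding expand[OF assms(1,2) x] expand[OF assms(2,1) y]
    by (simp add: S_adj[symmetric] A_adj[symmetric] A_S comm_scalar_prod[of "S *\<^sub>v (A *\<^sub>v x)" n y])
qed

text \<open>The inverse of R_w together with the symmetry and commutation that a function of
  \<open>A\<close> has. The parameter w is independent of the z behind \<open>S\<close>, as claim
  (4) compares two parameters.\<close>

definition resolvent :: "complex \<Rightarrow> complex mat \<Rightarrow> bool" where
  "resolvent w P \<longleftrightarrow> P \<in> carrier_mat n n \<and> transpose_mat P = P \<and> A * P = P * A \<and> S * P = P * S \<and>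
     R_mat A w * P = 1\<^sub>m n"

section \<open>Confocal quadrics through the resolvent\<close>

context
  fixes w P assumes P: "resolvent w P"
begin

lemma P_carrier: "P \<in> carrier_mat n n" and P_symmetric: "transpose_mat P = P"
  and P_commute: "A * P = P * A" "S * P = P * S" and R_P: "R_mat A w * P = 1\<^sub>m n"
  using P by (auto simp: resolvent_def)

lemma P_image: "v \<in> carrier_vec n \<Longrightarrow> P *\<^sub>v v \<in> carrier_vec n"
  by (rule mult_mat_vec_carrier[OF P_carrier])

lemma P_dims: "dim_row P = n" "dim_col P = n"
  using P_carrier by auto

lemma P_adj: "u \<in> carrier_vec n \<Longrightarrow> v \<in> carrier_vec n \<Longrightarrow> (P *\<^sub>v u) \<bullet> v = u \<bullet> (P *\<^sub>v v)"
  by (rule symmetric_scalar_prod[OF P_carrier P_symmetric])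

lemma A_P: "v \<in> carrier_vec n \<Longrightarrow> A *\<^sub>v (P *\<^sub>v v) = P *\<^sub>v (A *\<^sub>v v)"
  using P_commute(1) assoc_mult_mat_vec[OF A P_carrier, of v] assoc_mult_mat_vec[OF P_carrier A, of v] by simp

lemma S_P: "v \<in> carrier_vec n \<Longrightarrow> S *\<^sub>v (P *\<^sub>v v) = P *\<^sub>v (S *\<^sub>v v)"
  using P_commute(2) assoc_mult_mat_vec[OF S P_carrier, of v] assoc_mult_mat_vec[OF P_carrier S, of v] by simp

lemma P_eq:
  assumes v: "v \<in> carrier_vec n" shows "P *\<^sub>v v - w \<cdot>\<^sub>v (A *\<^sub>v (P *\<^sub>v v)) = v"
proof -
  note Pv = P_image[OF v]
  have R: "R_mat A w \<in> carrier_mat n n"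
    using minus_carrier_mat[OF smult_carrier_mat[OF A]] by (simp add: R_mat_def)
  have "v = (R_mat A w * P) *\<^sub>v v" using v by (simp add: R_P)
  also have "\<dots> = R_mat A w *\<^sub>v (P *\<^sub>v v)" by (rule assoc_mult_mat_vec[OF R P_carrier v])
  also have "\<dots> = 1\<^sub>m n *\<^sub>v (P *\<^sub>v v) - (w \<cdot>\<^sub>m A) *\<^sub>v (P *\<^sub>v v)"
    unfolding R_mat_def dims by (rule minus_mult_distrib_mat_vec[OF one_carrier_mat smult_carrier_mat[OF A] Pv])
  also have "\<dots> = P *\<^sub>v v - w \<cdot>\<^sub>v (A *\<^sub>v (P *\<^sub>v v))"
    using Pv by (simp add: smult_mat_mult_vec[OF A Pv])
  finally show ?thesis ..
qed

text \<open>w A P = P - I, kept with the factor w so that it also holds at w = 0.\<close>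

lemma w_A_P:
  assumes u: "u \<in> carrier_vec n" and v: "v \<in> carrier_vec n"
  shows "w * (u \<bullet> (A *\<^sub>v (P *\<^sub>v v))) = u \<bullet> (P *\<^sub>v v) - u \<bullet> v"
proof -
  note [simp] = P_image[OF v] u v
  have "u \<bullet> v = u \<bullet> (P *\<^sub>v v - w \<cdot>\<^sub>v (A *\<^sub>v (P *\<^sub>v v)))" by (simp add: P_eq)
  also have "\<dots> = u \<bullet> (P *\<^sub>v v) - w * (u \<bullet> (A *\<^sub>v (P *\<^sub>v v)))" by (simp add: dot_simps)
  finally show ?thesis by simp
qed

lemma AP_carrier: "A * P \<in> carrier_mat n n" and AP_symmetric: "transpose_mat (A * P) = A * P"
  using transpose_mult[OF A P_carrier] P_carrier A A_symmetric P_symmetric P_commute by auto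

lemma AP_normal:
  assumes x: "x \<in> carrier_vec n" shows "(A * P) *\<^sub>v x + P *\<^sub>v B = P *\<^sub>v nrm x"
proof -
  have "(A * P) *\<^sub>v x = P *\<^sub>v (A *\<^sub>v x)"
    unfolding assoc_mult_mat_vec[OF A P_carrier x] by (rule A_P[OF x])
  then show ?thesis unfolding nrm_def
    by (simp add: mult_add_distrib_mat_vec[OF P_carrier image_carrier(1)[OF x] B])
qed

text \<open>By w A P = P - I the difference Q_w(x) - Q_0(x) is w times the form of \<open>P\<close>
  at the half gradient, and Q_0(x) = 0.\<close>

lemma confocal_val:
  assumes x: "x \<in> carrier_vec n" and Qx: "quadric_val (A, B, C) x = 0"
  shows "quadric_val (A * P, P *\<^sub>v B, C + w * (B \<bullet> (P *\<^sub>v B))) x = w * (nrm x \<bullet> (P *\<^sub>v nrm x))"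
proof -
  note [simp] = x P_image image_carrier(1)[OF x]
  have Ax: "w * ((A *\<^sub>v x) \<bullet> (P *\<^sub>v v)) = x \<bullet> (P *\<^sub>v v) - x \<bullet> v" if "v \<in> carrier_vec n" for v
    using w_A_P[OF x that] by (simp add: A_adj that)
  have BPA: "B \<bullet> (P *\<^sub>v (A *\<^sub>v x)) = (A *\<^sub>v x) \<bullet> (P *\<^sub>v B)"
    using P_adj[OF B image_carrier(1)[OF x]] comm_scalar_prod[of "P *\<^sub>v B" n "A *\<^sub>v x"] by simp
  have "w * (nrm x \<bullet> (P *\<^sub>v nrm x))
     = w * ((A *\<^sub>v x) \<bullet> (P *\<^sub>v (A *\<^sub>v x))) + 2 * (w * ((A *\<^sub>v x) \<bullet> (P *\<^sub>v B))) + w * (B \<bullet> (P *\<^sub>v B))"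
    unfolding nrm_def
    by (simp add: mult_add_distrib_mat_vec[OF P_carrier] dot_simps BPA distrib_left)
  also have "\<dots> = x \<bullet> (P *\<^sub>v (A *\<^sub>v x)) + 2 * (x \<bullet> (P *\<^sub>v B)) + w * (B \<bullet> (P *\<^sub>v B)) - (x \<bullet> (A *\<^sub>v x) + 2 * (x \<bullet> B))"
    by (simp add: Ax algebra_simps)
  also have "x \<bullet> (A *\<^sub>v x) + 2 * (x \<bullet> B) = - C"
    using Qx by (simp add: dot_simps eq_neg_iff_add_eq_0)
  finally show ?thesis
    by (simp add: assoc_mult_mat_vec[OF A P_carrier x] A_P dot_simps P_dims)
qed

text \<open>The factor w in the value at x moves to the quadratic coefficient, where w A P = P - I
  eliminates \<open>A\<close>.\<close>

lemma line_tangent_confocal: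
  assumes x: "x \<in> carrier_vec n" and Qx: "quadric_val (A, B, C) x = 0" and V: "V \<in> carrier_vec n"
  shows "line_tangent (A * P, P *\<^sub>v B, C + w * (B \<bullet> (P *\<^sub>v B))) x V \<longleftrightarrow>
    (V \<bullet> (P *\<^sub>v nrm x))\<^sup>2 = (V \<bullet> (P *\<^sub>v V) - V \<bullet> V) * (nrm x \<bullet> (P *\<^sub>v nrm x))"
  unfolding line_tangent_iff[OF AP_carrier AP_symmetric P_image[OF B] x V] AP_normal[OF x]
    confocal_val[OF x Qx] assoc_mult_mat_vec[OF A P_carrier V] w_A_P[OF V V, symmetric]
  by (simp add: mult_ac)

text \<open>With \<open>N = - z \<nu>(x) = S V + U\<close> the defect of the tangency condition is
  \<open>m\<^sup>2 - p u + k (u + 2 m + p)\<close> below, which becomes symmetric in \<open>U\<close> and \<open>V\<close> as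
  \<open>S P S = P R\<^sub>z\<close> is a combination of \<open>P\<close> and the identity.\<close>

lemma line_tangent_chord:
  assumes x: "x \<in> carrier_vec n" and Qx: "quadric_val (A, B, C) x = 0"
    and y: "y \<in> carrier_vec n" and Qy: "quadric_val (A, B, C) y = 0"
  shows "line_tangent (A * P, P *\<^sub>v B, C + w * (B \<bullet> (P *\<^sub>v B))) x (chord x y) \<longleftrightarrow>
         line_tangent (A * P, P *\<^sub>v B, C + w * (B \<bullet> (P *\<^sub>v B))) y (chord y x)"
proof -
  define U V where "U = chord x y" and "V = chord y x"
  have UV [simp]: "U \<in> carrier_vec n" "V \<in> carrier_vec n" using x y by (auto simp: U_def V_def)
  note [simp] = P_image x y
  have norm: "U \<bullet> U = V \<bullet> V" unfolding U_def V_def by (rule chord_norm[OF x y Qx Qy])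
  consider "w = 0" | "z = 0" | "w \<noteq> 0" "z \<noteq> 0" by blast
  then show ?thesis
  proof cases
    \<comment> \<open>Here P = I, so both criteria say that the chord is orthogonal to the normal at
      its base point.\<close>
    case 1
    have "P *\<^sub>v v = v" if "v \<in> carrier_vec n" for v
    proof -
      have "0 \<cdot>\<^sub>v (A *\<^sub>v (P *\<^sub>v v)) = 0\<^sub>v n" by (rule eq_vecI) simp_all
      then show ?thesis using P_eq[OF that] P_image[OF that] 1 by simp
    qed
    then show ?thesis
      unfolding line_tangent_confocal[OF x Qx chord_carrier[OF x y]] line_tangent_confocal[OF y Qy chord_carrier[OF y x]]
      using chord_normal[OF x y Qx Qy] x y by simp
  next
    \<comment> \<open>Here S = I and 2 c = 0, so the two chords are opposite directions on one
      line.\<close>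
    case 2
    have "c $ i = 0" if "i < n" for i
      using arg_cong[OF S_shift, of "\<lambda>v. v $ i"] that 2 S_zero by simp
    then have c0: "c = 0\<^sub>v n" by (intro eq_vecI) auto
    have chord: "chord a b = b - a" if "a \<in> carrier_vec n" "b \<in> carrier_vec n" for a b
      using that by (simp only: chord_def) (simp add: S_zero[OF 2] c0)
    have reverse: "line_tangent Q a (b - a) \<Longrightarrow> line_tangent Q b (a - b)"
      if "a \<in> carrier_vec n" "b \<in> carrier_vec n" for Q a b
    proof -
      have "a + (b - a) = b" "- (b - a) = a - b" using that by auto
      then show "line_tangent Q a (b - a) \<Longrightarrow> line_tangent Q b (a - b)"
        using line_tangent_reverse[of a n "b - a" Q] that by simp
    qed
    show ?thesis unfolding chord[OF x y] chord[OF y x] using reverse[OF x y] reverse[OF y x] by blast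
  next
    case 3
    define p q k m where "p = U \<bullet> (P *\<^sub>v U)" and "q = V \<bullet> (P *\<^sub>v V)" and "k = V \<bullet> V"
      and "m = U \<bullet> (P *\<^sub>v (S *\<^sub>v V))"
    define u v where "u = (S *\<^sub>v V) \<bullet> (P *\<^sub>v (S *\<^sub>v V))" and "v = (S *\<^sub>v U) \<bullet> (P *\<^sub>v (S *\<^sub>v U))"
    \<comment> \<open>S P is symmetric as a product of commuting symmetric matrices, so the mixed
      term is the same from both ends.\<close>
    have m: "m = V \<bullet> (P *\<^sub>v (S *\<^sub>v U))"
    proof -
      have "m = (S *\<^sub>v U) \<bullet> (P *\<^sub>v V)" by (simp add: m_def S_P[symmetric] S_adj)
      also have "\<dots> = (P *\<^sub>v (S *\<^sub>v U)) \<bullet> V" by (simp add: P_adj)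
      also have "\<dots> = V \<bullet> (P *\<^sub>v (S *\<^sub>v U))" by (rule comm_scalar_prod[of _ n]) simp_all
      finally show ?thesis .
    qed
    \<comment> \<open>S P S = P S^2 = P - z A P, and the factor w makes A P expressible by P and
      I.\<close>
    have SPS: "w * ((S *\<^sub>v a) \<bullet> (P *\<^sub>v (S *\<^sub>v a))) = w * (a \<bullet> (P *\<^sub>v a)) - z * (a \<bullet> (P *\<^sub>v a) - a \<bullet> a)"
      if [simp]: "a \<in> carrier_vec n" for a
    proof -
      have "(S *\<^sub>v a) \<bullet> (P *\<^sub>v (S *\<^sub>v a)) = a \<bullet> (P *\<^sub>v (a - z \<cdot>\<^sub>v (A *\<^sub>v a)))"
        by (simp add: S_adj S_P S_S)
      also have "P *\<^sub>v (a - z \<cdot>\<^sub>v (A *\<^sub>v a)) = P *\<^sub>v a - z \<cdot>\<^sub>v (A *\<^sub>v (P *\<^sub>v a))"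
        by (simp add: mult_minus_distrib_mat_vec[OF P_carrier] mult_mat_vec[OF P_carrier] A_P)
      finally have "(S *\<^sub>v a) \<bullet> (P *\<^sub>v (S *\<^sub>v a)) = a \<bullet> (P *\<^sub>v a) - z * (a \<bullet> (A *\<^sub>v (P *\<^sub>v a)))"
        by (simp add: dot_simps)
      then show ?thesis unfolding w_A_P[OF that that, symmetric] by (simp only: right_diff_distrib mult.left_commute)
    qed
    have wu: "w * u = w * q - z * (q - k)" and wv: "w * v = w * p - z * (p - k)"
      unfolding u_def v_def SPS[OF UV(1)] SPS[OF UV(2)] by (simp_all add: p_def q_def k_def norm)
    \<comment> \<open>The criterion multiplied by z^2, with -z times the normal replaced by S E + D;
      stated once for use at both ends.\<close>
    have tan: "line_tangent (A * P, P *\<^sub>v B, C + w * (B \<bullet> (P *\<^sub>v B))) a D \<longleftrightarrow>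
       (D \<bullet> (P *\<^sub>v (S *\<^sub>v E)) + D \<bullet> (P *\<^sub>v D))\<^sup>2 = (D \<bullet> (P *\<^sub>v D) - D \<bullet> D) *
         ((S *\<^sub>v E) \<bullet> (P *\<^sub>v (S *\<^sub>v E)) + 2 * (D \<bullet> (P *\<^sub>v (S *\<^sub>v E))) + D \<bullet> (P *\<^sub>v D))"
      if [simp]: "a \<in> carrier_vec n" "D \<in> carrier_vec n" "E \<in> carrier_vec n"
        and Qa: "quadric_val (A, B, C) a = 0" and E: "S *\<^sub>v E = - z \<cdot>\<^sub>v nrm a - D" for a D E
    proof -
      define N where "N = nrm a"
      have [simp]: "N \<in> carrier_vec n" by (simp add: N_def)
      have PSE: "P *\<^sub>v (S *\<^sub>v E) = - z \<cdot>\<^sub>v (P *\<^sub>v N) - P *\<^sub>v D"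
        unfolding E N_def[symmetric]
        by (simp add: mult_minus_distrib_mat_vec[OF P_carrier] mult_mat_vec[OF P_carrier])
      have PN: "D \<bullet> (P *\<^sub>v (S *\<^sub>v E)) = - z * (D \<bullet> (P *\<^sub>v N)) - D \<bullet> (P *\<^sub>v D)"
        unfolding PSE by (simp add: dot_simps P_dims)
      have "N \<bullet> (P *\<^sub>v D) = D \<bullet> (P *\<^sub>v N)"
        using P_adj[of N D] comm_scalar_prod[of "P *\<^sub>v N" n D] by simp
      then have NN: "(S *\<^sub>v E) \<bullet> (P *\<^sub>v (S *\<^sub>v E)) = z\<^sup>2 * (N \<bullet> (P *\<^sub>v N)) + 2 * z * (D \<bullet> (P *\<^sub>v N)) + D \<bullet> (P *\<^sub>v D)"
        unfolding PSE unfolding E N_def[symmetric]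
        by (simp add: dot_simps P_dims power2_eq_square algebra_simps)
      have lhs: "(D \<bullet> (P *\<^sub>v (S *\<^sub>v E)) + D \<bullet> (P *\<^sub>v D))\<^sup>2 = z\<^sup>2 * (D \<bullet> (P *\<^sub>v N))\<^sup>2"
        unfolding PN by (simp add: power2_eq_square)
      have rhs: "(D \<bullet> (P *\<^sub>v D) - D \<bullet> D) *
          ((S *\<^sub>v E) \<bullet> (P *\<^sub>v (S *\<^sub>v E)) + 2 * (D \<bullet> (P *\<^sub>v (S *\<^sub>v E))) + D \<bullet> (P *\<^sub>v D))
        = z\<^sup>2 * ((D \<bullet> (P *\<^sub>v D) - D \<bullet> D) * (N \<bullet> (P *\<^sub>v N)))"
        unfolding PN NN by (simp add: algebra_simps)
      show ?thesis
        unfolding lhs rhs line_tangent_confocal[OF that(1) Qa that(2)] N_def[symmetric]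
        using \<open>z \<noteq> 0\<close> by simp
    qed
    \<comment> \<open>Each defect times w equals w (m^2 - p q + k (p + q + 2 m)) + z (p - k)(q - k),
      which is unchanged when p and q are exchanged.\<close>
    have "w * (((m + p)\<^sup>2 - (p - k) * (u + 2 * m + p)) - ((m + q)\<^sup>2 - (q - k) * (v + 2 * m + q)))
       = - (p - k) * (w * u) + (q - k) * (w * v) + w * k * (p - q)"
      by (simp add: power2_eq_square algebra_simps)
    also have "\<dots> = 0" unfolding wu wv by (simp add: algebra_simps)
    finally have "(m + p)\<^sup>2 - (p - k) * (u + 2 * m + p) = (m + q)\<^sup>2 - (q - k) * (v + 2 * m + q)"
      using \<open>w \<noteq> 0\<close> by simp
    then have eq: "(m + p)\<^sup>2 = (p - k) * (u + 2 * m + p) \<longleftrightarrow> (m + q)\<^sup>2 = (q - k) * (v + 2 * m + q)"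
      by (metis eq_iff_diff_eq_0)
    show ?thesis
      using eq
      unfolding tan[OF x UV Qx S_chord[OF x y, folded U_def V_def]] tan[OF y UV(2,1) Qy S_chord[OF y x, folded U_def V_def]]
        U_def[symmetric] V_def[symmetric] p_def[symmetric] q_def[symmetric] m_def[symmetric] m[symmetric]
        u_def[symmetric] v_def[symmetric] k_def[symmetric] norm .
  qed
qed

end

section \<open>Transport of tangent spaces and reflections\<close>

lemma affine_carrier: "x \<in> carrier_vec n \<Longrightarrow> S *\<^sub>v x + c \<in> carrier_vec n"
  by simp

text \<open>By A c + B = S B, the half gradient of x_0 at S x + c is S applied to the half gradient
  at x; the confocal quadric adds the factor \<open>P\<close>.\<close>

lemma confocal_normal:
  assumes P: "resolvent z P" and x: "x \<in> carrier_vec n"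
  shows "(A * P) *\<^sub>v (S *\<^sub>v x + c) + P *\<^sub>v B = P *\<^sub>v (S *\<^sub>v nrm x)"
proof -
  have "nrm (S *\<^sub>v x + c) = S *\<^sub>v nrm x"
    using x unfolding nrm_def
    by (simp add: mult_add_distrib_mat_vec[OF A] mult_add_distrib_mat_vec[OF S] A_S A_shift)
      (intro eq_vecI, simp_all)
  then show ?thesis using AP_normal[OF P affine_carrier[OF x]] by simp
qed

text \<open>\<open>P\<close> inverts S^2 and commutes with \<open>S\<close>, so P S is the inverse
  of \<open>S\<close>.\<close>

lemma S_P_S:
  assumes P: "resolvent z P" and v: "v \<in> carrier_vec n"
  shows "S *\<^sub>v (P *\<^sub>v (S *\<^sub>v v)) = v" "S *\<^sub>v (S *\<^sub>v (P *\<^sub>v v)) = v"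
proof -
  have "S *\<^sub>v (S *\<^sub>v (P *\<^sub>v v)) = v"
    unfolding S_S[OF P_image[OF P v]] by (rule P_eq[OF P v])
  then show "S *\<^sub>v (S *\<^sub>v (P *\<^sub>v v)) = v" "S *\<^sub>v (P *\<^sub>v (S *\<^sub>v v)) = v"
    by (simp_all add: S_P[OF P v])
qed

text \<open>On tangent vectors the normal term of \<open>S_chord\<close> drops out, and the rest is
  linear in the chords, so the roots and the sign are carried along unchanged.\<close>

lemma reflect_signed_iff:
  assumes P: "resolvent z P"
    and x: "x \<in> carrier_vec n" and y: "y \<in> carrier_vec n" and y': "y' \<in> carrier_vec n"
  shows "reflect_signed (A * P, P *\<^sub>v B, g) (S *\<^sub>v x + c) s l (chord y x) m (chord y' x)
    \<longleftrightarrow> reflect_signed (A, B, C) x s l (chord x y) m (chord x y')"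
proof -
  note [simp] = x y y' P_image[OF P]
  define W where "W = (1 / l) \<cdot>\<^sub>v chord y x + s \<cdot>\<^sub>v ((1 / m) \<cdot>\<^sub>v chord y' x)"
  define U where "U = (1 / l) \<cdot>\<^sub>v chord x y + s \<cdot>\<^sub>v ((1 / m) \<cdot>\<^sub>v chord x y')"
  have [simp]: "W \<in> carrier_vec n" "U \<in> carrier_vec n" by (simp_all add: W_def U_def)
  have dual: "d \<bullet> U = - ((S *\<^sub>v d) \<bullet> W)" if [simp]: "d \<in> carrier_vec n" and d: "d \<bullet> nrm x = 0" for d
  proof -
    have "d \<bullet> (S *\<^sub>v chord a x) = - (d \<bullet> chord x a)" if [simp]: "a \<in> carrier_vec n" for a
      using d by (simp add: S_chord dot_simps scalar_prod_smult_distrib[of _ n])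
    then show ?thesis by (simp add: S_adj W_def U_def dot_simps scalar_prod_smult_distrib[of _ n] mult_add_distrib_mat_vec[OF S] mult_mat_vec[OF S])
  qed
  have normal: "normal_at (A * P, P *\<^sub>v B, g) (S *\<^sub>v x + c) = P *\<^sub>v (S *\<^sub>v nrm x)"
    by (simp add: confocal_normal[OF P])
  have "(\<forall>d. d \<in> carrier_vec n \<and> d \<bullet> (P *\<^sub>v (S *\<^sub>v nrm x)) = 0 \<longrightarrow> d \<bullet> W = 0)
    \<longleftrightarrow> (\<forall>d. d \<in> carrier_vec n \<and> d \<bullet> nrm x = 0 \<longrightarrow> d \<bullet> U = 0)" (is "?L \<longleftrightarrow> ?R")
  proof
    assume L: ?L
    show ?R
    proof (intro allI impI)
      fix d assume d: "d \<in> carrier_vec n \<and> d \<bullet> nrm x = 0"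
      then have "(S *\<^sub>v d) \<bullet> (P *\<^sub>v (S *\<^sub>v nrm x)) = 0"
        by (simp add: S_adj S_P_S[OF P])
      then show "d \<bullet> U = 0" using L d by (simp add: dual)
    qed
  next
    assume R: ?R
    show ?L
    proof (intro allI impI)
      fix d assume d: "d \<in> carrier_vec n \<and> d \<bullet> (P *\<^sub>v (S *\<^sub>v nrm x)) = 0"
      \<comment> \<open>S P is the inverse of \<open>S\<close>, so \<open>e\<close> is the tangent
        vector of x_0 that \<open>S\<close> sends to \<open>d\<close>.\<close>
      define e where "e = S *\<^sub>v (P *\<^sub>v d)"
      have e: "e \<in> carrier_vec n" "S *\<^sub>v e = d" using d by (simp_all add: e_def S_P_S[OF P])
      have "e \<bullet> nrm x = 0" using d by (simp add: e_def S_adj P_adj[OF P])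
      then show "d \<bullet> W = 0" using R e dual[of e] by simp
    qed
  qed
  moreover have dims: "dim_vec (S *\<^sub>v x + c) = n" "dim_vec x = n" and "normal_at (A, B, C) x = nrm x"
    by (simp_all add: nrm_def carrier_vecD[OF x])
  ultimately show ?thesis
    unfolding reflect_signed_def tangent_at_def normal dims W_def[symmetric] U_def[symmetric] by simp
qed

lemma reflect_iff:
  assumes P: "resolvent z P"
    and x: "x \<in> carrier_vec n" "quadric_val (A, B, C) x = 0"
    and y: "y \<in> carrier_vec n" "quadric_val (A, B, C) y = 0"
    and y': "y' \<in> carrier_vec n" "quadric_val (A, B, C) y' = 0"
  shows "reflect (A * P, P *\<^sub>v B, g) (S *\<^sub>v x + c) (chord y x) (chord y' x)
    \<longleftrightarrow> reflect (A, B, C) x (chord x y) (chord x y')"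
  unfolding reflect_def reflect_signed_iff[OF P x(1) y(1) y'(1)]
    chord_norm[OF x(1) y(1) x(2) y(2)] chord_norm[OF x(1) y'(1) x(2) y'(2)] ..

end

text \<open>For unit vectors \<open>u\<close>, \<open>u'\<close> with \<open>u + u' = k N\<close>, pairing with \<open>u\<close> and with \<open>u'\<close> gives
  \<open>k (u \<bullet> N) = k (u' \<bullet> N)\<close>; hence either \<open>u = - u'\<close> or \<open>u \<bullet> N = u' \<bullet> N\<close>.\<close>

lemma reflect_cases:
  assumes N: "x \<in> carrier_vec n" "normal_at q x \<in> carrier_vec n"
    and V: "V \<in> carrier_vec n" "V \<bullet> V \<noteq> 0" and W: "W \<in> carrier_vec n" "W \<bullet> W \<noteq> 0"
    and refl: "reflect q x V W"
  shows "(\<exists>r. r \<noteq> 0 \<and> V \<bullet> normal_at q x = r * (W \<bullet> normal_at q x))"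
    and "V \<bullet> normal_at q x = 0 \<Longrightarrow> W \<bullet> normal_at q x = 0 \<Longrightarrow> normal_at q x \<bullet> normal_at q x \<noteq> 0
      \<Longrightarrow> \<exists>r. V = r \<cdot>\<^sub>v W"
proof -
  define N where "N = normal_at q x"
  have [simp]: "N \<in> carrier_vec n" "V \<in> carrier_vec n" "W \<in> carrier_vec n" "dim_vec x = n"
    using assms by (auto simp: N_def)
  obtain l m s where l: "l\<^sup>2 = V \<bullet> V" and m: "m\<^sup>2 = W \<bullet> W" and s: "s \<in> {1, - 1}"
    and signed: "reflect_signed q x s l V m W"
    using refl unfolding reflect_def by blast
  have lm: "l \<noteq> 0" "m \<noteq> 0" using l m V W by auto
  have s2: "s * s = 1" "s \<noteq> 0" using s by auto
  define U where "U = (1 / l) \<cdot>\<^sub>v V + s \<cdot>\<^sub>v ((1 / m) \<cdot>\<^sub>v W)"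
  have [simp]: "U \<in> carrier_vec n" by (simp add: U_def)
  have "d \<bullet> U = 0" if "d \<in> carrier_vec n" "d \<bullet> N = 0" for d
    using signed that unfolding reflect_signed_def tangent_at_def U_def N_def by simp
  then obtain k where k: "U = k \<cdot>\<^sub>v N" using mem_span_of_annihilator[of U n N] by auto
  have dot: "a \<bullet> V / l + s * (a \<bullet> W) / m = k * (a \<bullet> N)" if [simp]: "a \<in> carrier_vec n" for a
  proof -
    have "a \<bullet> U = a \<bullet> V / l + s * (a \<bullet> W) / m"
      unfolding U_def by (simp add: scalar_prod_add_distrib[of _ n] scalar_prod_smult_distrib[of _ n])
    then show ?thesis by (simp add: k scalar_prod_smult_distrib[of _ n])
  qed
  define \<mu> \<nu> g where "\<mu> = V \<bullet> N" and "\<nu> = W \<bullet> N" and "g = V \<bullet> W"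
  have comm: "W \<bullet> V = g" "N \<bullet> V = \<mu>" "N \<bullet> W = \<nu>"
    unfolding g_def \<mu>_def \<nu>_def by (rule comm_scalar_prod[of _ n]; simp)+
  have dotV: "l\<^sup>2 / l + s * g / m = k * \<mu>" and dotW: "g / l + s * m\<^sup>2 / m = k * \<nu>"
    and dotN: "\<mu> / l + s * \<nu> / m = k * (N \<bullet> N)"
    using dot[of V] dot[of W] dot[of N] by (simp_all add: comm l m g_def[symmetric] \<mu>_def[symmetric] \<nu>_def[symmetric])
  have "k * (\<mu> / l) = (l\<^sup>2 / l + s * g / m) / l" "k * (s * \<nu> / m) = s * (g / l + s * m\<^sup>2 / m) / m"
    unfolding dotV dotW by simp_all
  then have eq: "k * (\<mu> / l) = k * (s * \<nu> / m)"
    using lm s by (auto simp: power2_eq_square field_simps)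
  show "\<exists>r. r \<noteq> 0 \<and> V \<bullet> normal_at q x = r * (W \<bullet> normal_at q x)"
  \<comment> \<open>The factor is -s l/m if k = 0 and s l/m otherwise; it is nonzero because l and m
    are roots of nonzero numbers.\<close>
  proof (cases "k = 0")
    case True
    then have "\<mu> = (- s * l / m) * \<nu>" using dotN lm by (simp add: field_simps eq_neg_iff_add_eq_0)
    then show ?thesis using lm s2 unfolding \<mu>_def \<nu>_def N_def
      by (intro exI[of _ "- s * l / m"]) simp
  next
    case False
    then have "\<mu> = (s * l / m) * \<nu>" using eq lm by (simp add: field_simps)
    then show ?thesis using lm s2 unfolding \<mu>_def \<nu>_def N_def
      by (intro exI[of _ "s * l / m"]) simp
  qed
  assume "V \<bullet> normal_at q x = 0" "W \<bullet> normal_at q x = 0" "normal_at q x \<bullet> normal_at q x \<noteq> 0"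
  \<comment> \<open>Both normal components vanish, so k |N|^2 = 0, and the nonisotropic normal
    leaves only k = 0: the vectors are parallel.\<close>
  then have "k = 0" using dotN by (simp add: \<mu>_def \<nu>_def N_def)
  have "V $ i = (- s * l / m) * W $ i" if "i < n" for i
  proof -
    have dims: "dim_vec V = n" "dim_vec W = n" by (simp_all add: carrier_vecD[OF V(1)] carrier_vecD[OF W(1)])
    have "U $ i = 0" using \<open>k = 0\<close> that k by (simp add: N_def carrier_vecD[OF N(2)])
    then have "V $ i / l + s * (W $ i / m) = 0"
      using that dims unfolding U_def by simp
    then show ?thesis using lm by (simp add: field_simps eq_neg_iff_add_eq_0)
  qed
  then show "\<exists>r. V = r \<cdot>\<^sub>v W"
    by (intro exI[of _ "- s * l / m"] eq_vecI) (auto simp: carrier_vecD[OF V(1)] carrier_vecD[OF W(1)])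
qed

section \<open>Canonical quadrics as an instance\<close>

lemma SJ_resolvent:
  assumes pos: "\<And>a p. (a, p) \<in> set bs \<Longrightarrow> 1 \<le> p" and w: "confocal_param (SJ_mat bs) w"
  shows "\<exists>F. inv_mat (R_mat (SJ_mat bs) w) = SJ_fun bs F"
    and "R_mat (SJ_mat bs) w * inv_mat (R_mat (SJ_mat bs) w) = 1\<^sub>m (SJ_size bs)"
proof -
  have A: "SJ_mat bs = SJ_fun bs (\<lambda>a. fps_const a + fps_X)" by (rule SJ_mat_eq_SJ_fun) (rule pos)
  show "R_mat (SJ_mat bs) w * inv_mat (R_mat (SJ_mat bs) w) = 1\<^sub>m (SJ_size bs)"
    by (rule confocal_param_inverse(2)) (use w in \<open>simp_all add: A\<close>)
  have R: "R_mat (SJ_mat bs) w = SJ_fun bs (\<lambda>a. 1 - fps_const w * (fps_const a + fps_X))"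
    by (rule R_mat_eq_SJ_fun) (rule pos)
  have "inv_mat (SJ_fun bs (\<lambda>a. 1 - fps_const w * (fps_const a + fps_X)))
    = SJ_fun bs (\<lambda>a. inverse (1 - fps_const w * (fps_const a + fps_X)))"
    by (rule SJ_fun_inverse(2)) (use confocal_param_germ[OF pos w] in simp)
  then show "\<exists>F. inv_mat (R_mat (SJ_mat bs) w) = SJ_fun bs F"
    unfolding R by blast
qed

lemma sqrt_R_zero: "sqrt_R bs 0 = 1\<^sub>m (SJ_size bs)"
proof -
  have "sqrt_germ 0 = (\<lambda>_. 1)"
    by (intro ext fps_ext) (simp add: sqrt_germ_nth power_0_left)
  then show ?thesis by (simp add: sqrt_R_eq_SJ_fun SJ_fun_one)
qed

text \<open>The canonical form enters through the dimension and support of \<open>B\<close>, which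
  give the identities for the shift; the remaining conditions are germ identities.\<close>

lemma ivory_affinity_canonical:
  assumes pos: "\<And>a p. (a, p) \<in> set bs \<Longrightarrow> 1 \<le> p" and n: "SJ_size bs = n" "1 \<le> n"
    and can: "canonical_quadric n (SJ_mat bs) B C" and z: "confocal_param (SJ_mat bs) z"
  shows "ivory_affinity n (SJ_mat bs) (sqrt_R bs z) B (ivory_shift bs B z) z"
proof -
  have A: "SJ_mat bs = SJ_fun bs (\<lambda>a. fps_const a + fps_X)" by (rule SJ_mat_eq_SJ_fun) (rule pos)
  have B: "B \<in> carrier_vec (SJ_size bs)" using canonical_carrier[OF can] by (simp add: n)
  note shift = ivory_shift_identities[OF pos B, unfolded n, OF _ canonical_germ_col[OF pos n can]]
  have "sqrt_R bs z * sqrt_R bs z = R_mat (SJ_mat bs) z"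
  proof -
    have "SJ_fun bs (\<lambda>a. sqrt_germ z a * sqrt_germ z a) = SJ_fun bs (\<lambda>a. 1 - fps_const z * (fps_const a + fps_X))"
      by (rule SJ_fun_cong) (rule sqrt_germ_square, rule confocal_param_germ[OF pos z])
    also have "\<dots> = R_mat (SJ_mat bs) z"
      by (rule R_mat_eq_SJ_fun[symmetric]) (rule pos)
    finally show ?thesis unfolding sqrt_R_eq_SJ_fun SJ_fun_mult .
  qed
  moreover have "transpose_mat (SJ_mat bs) = SJ_mat bs" "transpose_mat (sqrt_R bs z) = sqrt_R bs z"
    "SJ_mat bs * sqrt_R bs z = sqrt_R bs z * SJ_mat bs"
    unfolding A sqrt_R_eq_SJ_fun by (rule SJ_fun_transpose SJ_fun_commute)+
  moreover have "SJ_mat bs \<in> carrier_mat n n" "sqrt_R bs z \<in> carrier_mat n n"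
    unfolding A sqrt_R_eq_SJ_fun n(1)[symmetric] by simp_all
  moreover have "z = 0 \<Longrightarrow> sqrt_R bs z = 1\<^sub>m n" by (simp add: sqrt_R_zero n)
  ultimately show ?thesis
    using B n shift by unfold_locales auto
qed

theorem proposition6p1:
  fixes n :: nat
    and bs :: "(complex \<times> nat) list"
    and A :: "complex mat" and B :: "complex vec" and C z :: complex
    and x xz :: "nat \<Rightarrow> complex vec"
    and V :: "nat \<Rightarrow> nat \<Rightarrow> complex vec"
    and Q0 Qz :: quadric
  assumes SJ: "SJ_blocks (n + 1) bs" "A = SJ_mat bs"
    and canonical: "canonical_quadric (n + 1) A B C"
    and z: "confocal_param A z"
    and Q0: "Q0 = (A, B, C)"
    and Qz: "Qz = confocal A B C z"
    and x: "\<And>j. j \<in> {0, 1, 2} \<Longrightarrow> on_quadric (n + 1) Q0 (x j)"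
    and xz: "\<And>j. xz j = ivory bs B z (x j)"
    and V: "\<And>j k. V j k = xz k - x j"
  shows
    "(V 0 1 \<bullet> V 0 1 \<noteq> 0 \<and> V 0 2 \<bullet> V 0 2 \<noteq> 0 \<longrightarrow>
        (reflect Qz (xz 0) (V 1 0) (V 2 0) \<longleftrightarrow> reflect Q0 (x 0) (V 0 1) (V 0 2))
      \<and> (\<forall>l1 l2. l1\<^sup>2 = V 0 1 \<bullet> V 0 1 \<and> l2\<^sup>2 = V 0 2 \<bullet> V 0 2 \<longrightarrow>
            l1\<^sup>2 = V 1 0 \<bullet> V 1 0 \<and> l2\<^sup>2 = V 2 0 \<bullet> V 2 0
          \<and> (\<forall>s \<in> {1, -1}. reflect_signed Qz (xz 0) s l1 (V 1 0) l2 (V 2 0)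
                \<longleftrightarrow> reflect_signed Q0 (x 0) s l1 (V 0 1) l2 (V 0 2)))
      \<and> (reflect Q0 (x 0) (V 0 1) (V 0 2) \<longrightarrow>
            (tangent_at Q0 (x 1) (V 1 0) \<longleftrightarrow> tangent_at Q0 (x 2) (V 2 0)))
      \<and> (reflect Q0 (x 0) (V 0 1) (V 0 2) \<and>
            tangent_at Q0 (x 1) (V 1 0) \<and> tangent_at Q0 (x 2) (V 2 0) \<and>
            normal_at Q0 (x 0) \<bullet> normal_at Q0 (x 0) \<noteq> 0 \<longrightarrow>
            collinear_cvec (n + 1) {xz 1, x 0, xz 2}))
   \<and> (\<forall>z'. confocal_param A z' \<longrightarrow>
        (line_tangent (confocal A B C z') (x 0) (V 0 1)
          \<longleftrightarrow> line_tangent (confocal A B C z') (x 1) (V 1 0)))"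
proof -
  define N where "N = n + 1"
  have pos: "1 \<le> p" if "(a, p) \<in> set bs" for a p using SJ(1) that by (auto simp: SJ_blocks_def)
  have size: "SJ_size bs = N" using SJ(1) by (simp add: SJ_blocks_def SJ_size_def N_def)
  define S c where "S = sqrt_R bs z" and "c = ivory_shift bs B z"
  interpret ivory_affinity N A S B c z C
    unfolding S_def c_def SJ(2)
    by (rule ivory_affinity_canonical[OF pos size])
      (use canonical z in \<open>simp_all add: N_def SJ(2)\<close>)
  have X: "x j \<in> carrier_vec N" "quadric_val (A, B, C) (x j) = 0" if "j \<in> {0, 1, 2}" for j
    using x[OF that] unfolding Q0 on_quadric_def N_def by auto
  have X0: "x 0 \<in> carrier_vec N" "quadric_val (A, B, C) (x 0) = 0"
    and X1: "x 1 \<in> carrier_vec N" "quadric_val (A, B, C) (x 1) = 0"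
    and X2: "x 2 \<in> carrier_vec N" "quadric_val (A, B, C) (x 2) = 0"
    by (rule X, simp)+
  have xz_eq: "xz j = S *\<^sub>v x j + c" for j by (simp add: xz ivory_def S_def c_def)
  have V_eq: "V j k = chord (x j) (x k)" for j k by (simp add: V xz_eq chord_def)
  \<comment> \<open>The inverse of R_w is itself a germ function of \<open>A\<close>, hence
    symmetric and commuting with \<open>A\<close> and \<open>S\<close>.\<close>
  have resolvent: "resolvent w (inv_mat (R_mat A w))" if w: "confocal_param A w" for w
  proof -
    have "\<exists>F. inv_mat (R_mat A w) = SJ_fun bs F"
      unfolding SJ(2) by (rule SJ_resolvent(1)[OF _ w[unfolded SJ(2)]]) (rule pos)
    then obtain F where F: "inv_mat (R_mat A w) = SJ_fun bs F" by blast
    have A: "A = SJ_fun bs (\<lambda>a. fps_const a + fps_X)"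
      unfolding SJ(2) by (rule SJ_mat_eq_SJ_fun) (rule pos)
    have "R_mat A w * inv_mat (R_mat A w) = 1\<^sub>m N"
      unfolding SJ(2) size[symmetric] by (rule SJ_resolvent(2)[OF _ w[unfolded SJ(2)]]) (rule pos)
    then show ?thesis
      unfolding resolvent_def F
      using SJ_fun_commute[of bs] SJ_fun_carrier[of bs F] unfolding A S_def sqrt_R_eq_SJ_fun
      by (simp add: SJ_fun_transpose size)
  qed
  define P where "P = inv_mat (R_mat A z)"
  have P: "resolvent z P" unfolding P_def by (rule resolvent[OF z])
  have Qz_eq: "Qz = (A * P, P *\<^sub>v B, C + z * (B \<bullet> (P *\<^sub>v B)))"
    by (simp add: Qz confocal_def P_def Let_def)
  have normal: "normal_at Q0 a = nrm a" for a by (simp add: Q0 nrm_def)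
  \<comment> \<open>Tangency at the separate points x_1 and x_2 becomes orthogonality to the single
    normal at x_0, where the reflection takes place.\<close>
  have tangent: "tangent_at Q0 (x j) (V j 0) \<longleftrightarrow> V 0 j \<bullet> normal_at Q0 (x 0) = 0" if "j \<in> {1, 2}" for j
  proof -
    from that have Xj: "x j \<in> carrier_vec N" "quadric_val (A, B, C) (x j) = 0" using X1 X2 by auto
    have "V j 0 \<in> carrier_vec (dim_vec (x j))"
      unfolding carrier_vecD[OF Xj(1)] V_eq using Xj(1) X0(1) by (rule chord_carrier)
    then show ?thesis
      unfolding tangent_at_def normal unfolding V_eq
      using chord_normal[OF X0(1) Xj(1) X0(2) Xj(2)] by simp
  qed
  have four: "line_tangent (confocal A B C w) (x 0) (V 0 1) \<longleftrightarrow> line_tangent (confocal A B C w) (x 1) (V 1 0)"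
    if "confocal_param A w" for w
    using line_tangent_chord[OF resolvent[OF that] X0 X1] by (simp add: confocal_def Let_def V_eq)
  have norms: "V 0 1 \<bullet> V 0 1 = V 1 0 \<bullet> V 1 0" "V 0 2 \<bullet> V 0 2 = V 2 0 \<bullet> V 2 0"
    unfolding V_eq using chord_norm[OF X0(1) X1(1) X0(2) X1(2)] chord_norm[OF X0(1) X2(1) X0(2) X2(2)] by auto
  have one: "reflect Qz (xz 0) (V 1 0) (V 2 0) \<longleftrightarrow> reflect Q0 (x 0) (V 0 1) (V 0 2)"
    unfolding Qz_eq Q0 V_eq xz_eq by (rule reflect_iff[OF P X0 X1 X2])
  have one_signed: "reflect_signed Qz (xz 0) s l (V 1 0) m (V 2 0)
      \<longleftrightarrow> reflect_signed Q0 (x 0) s l (V 0 1) m (V 0 2)" for s l m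
    unfolding Qz_eq Q0 V_eq xz_eq by (rule reflect_signed_iff[OF P X0(1) X1(1) X2(1)])
  have carrier: "V 0 1 \<in> carrier_vec N" "V 0 2 \<in> carrier_vec N" "normal_at Q0 (x 0) \<in> carrier_vec N"
    unfolding V_eq normal using X0(1) X1(1) X2(1) by simp_all
  have two: "tangent_at Q0 (x 1) (V 1 0) \<longleftrightarrow> tangent_at Q0 (x 2) (V 2 0)"
    if "V 0 1 \<bullet> V 0 1 \<noteq> 0" "V 0 2 \<bullet> V 0 2 \<noteq> 0" "reflect Q0 (x 0) (V 0 1) (V 0 2)"
    using reflect_cases(1)[OF X0(1) carrier(3,1) that(1) carrier(2) that(2,3)]
    by (auto simp: tangent)
  have three: "collinear_cvec (n + 1) {xz 1, x 0, xz 2}"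
    if refl: "V 0 1 \<bullet> V 0 1 \<noteq> 0" "V 0 2 \<bullet> V 0 2 \<noteq> 0" "reflect Q0 (x 0) (V 0 1) (V 0 2)"
      and tan: "tangent_at Q0 (x 1) (V 1 0)" "tangent_at Q0 (x 2) (V 2 0)"
      and nondeg: "normal_at Q0 (x 0) \<bullet> normal_at Q0 (x 0) \<noteq> 0"
  proof -
    obtain r where r: "V 0 1 = r \<cdot>\<^sub>v V 0 2"
      using reflect_cases(2)[OF X0(1) carrier(3,1) refl(1) carrier(2) refl(2,3)] tan nondeg
      by (auto simp: tangent)
    have xz_V: "xz j = x 0 + V 0 j" if "x j \<in> carrier_vec N" for j
      unfolding V using that X0(1) affine_carrier[OF that] xz_eq[of j] by auto
    \<comment> \<open>Base point x_0 and direction \<open>V 0 2\<close>, with parameters r, 0 and 1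
      for the three points.\<close>
    have "\<exists>\<tau>. y = x 0 + \<tau> \<cdot>\<^sub>v V 0 2" if "y \<in> {xz 1, x 0, xz 2}" for y
    proof -
      have "xz 1 = x 0 + r \<cdot>\<^sub>v V 0 2" "x 0 = x 0 + 0 \<cdot>\<^sub>v V 0 2" "xz 2 = x 0 + 1 \<cdot>\<^sub>v V 0 2"
        using xz_V[OF X1(1)] xz_V[OF X2(1)] X0(1) carrier(2) unfolding r by auto
      then show ?thesis using that by blast
    qed
    then show ?thesis
      unfolding N_def[symmetric] by (rule collinear_cvecI[OF X0(1) carrier(2)])
  qed
  show ?thesis
    using one one_signed norms two three four by simp
qed

end
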